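(* Let $n\ge 2$ and $r\ge 2$ be integers. Then $\mathbb{E}(n,r)\neq\emptyset$ if and only if $n\ge 3$ and $r\ge 3$.
   Context: We work over an algebraically closed field of characteristic $0$. For a multiprojective space $Y=\mathbb{P}^{n_1}\times\cdots\times\mathbb{P}^{n_k}$ (all $n_i>0$), $\pi_i$ is the projection onto the $i$-th factor; for $p\in Y$, $(2p,Y)$ is the closed subscheme of $Y$ with ideal sheaf $(\mathcal{I}_{p,Y})^2$, and for a finite set $S\subset Y$, $(2S,Y)=\bigcup_{p\in S}(2p,Y)$. Put $\delta(2S,Y):=h^1(Y,\mathcal{I}_{(2S,Y)}(1,\dots,1))$. $S(Y,r)$ is the set of subsets of $Y$ of cardinality $r$. $Y$ is the minimal multiprojective space containing $S$ if $\langle\pi_i(S)\rangle=\mathbb{P}^{n_i}$ for all $i$. Define $$\mathbb{T}_1(Y,r)=\{S\in S(Y,r)\mid h^0(\mathcal{I}_{(2S,Y)}(1,\dots,1))>0\text{ and }\delta(2S,Y)>0\},$$ $$\mathbb{T}(Y,r)=\{S\in\mathbb{T}_1(Y,r)\mid Y\text{ is the minimal multiprojective space containing }S\}.$$ $\mathbb{E}(n,r)$ is the set of pairs $(Y,S)$ where $Y$ is (the isomorphism class of) a multiprojective space of dimension $n$ and $S\in\mathbb{T}(Y,r)$. *)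

theory Defs
  imports "Jordan_Normal_Form.VS_Connect" "HOL-Library.Poly_Mapping" "HOL-Library.Extended_Nat"
begin

section \<open>Multiprojective spaces and their points\<close>

text \<open>The multiprojective space \<open>P^{n_1} \<times> \<dots> \<times> P^{n_k}\<close> is given by the list \<open>[n_1, \<dots>, n_k]\<close>.\<close>

type_synonym mspace = "nat list"

text \<open>A point of \<open>P^m\<close> is the set of all its vectors of homogeneous coordinates.\<close>

type_synonym 'a ppoint = "'a vec set"
type_synonym 'a mpoint = "'a ppoint list"

definition multiprojective :: "mspace \<Rightarrow> bool" where
  "multiprojective Y \<longleftrightarrow> Y \<noteq> [] \<and> (\<forall>n\<in>set Y. n > 0)"

definition proj_space :: "nat \<Rightarrow> 'a::field ppoint set" where
  "proj_space m = {{c \<cdot>\<^sub>v v | c. c \<noteq> 0} | v. v \<in> carrier_vec (Suc m) \<and> v \<noteq> 0\<^sub>v (Suc m)}"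

definition proj_span :: "nat \<Rightarrow> 'a::field ppoint set \<Rightarrow> 'a ppoint set" where
  "proj_span m A =
     {q \<in> proj_space m. q \<subseteq> LinearCombinations.module.span class_ring (module_vec TYPE('a) (Suc m)) (\<Union>A)}"

definition mpoints :: "mspace \<Rightarrow> 'a::field mpoint set" where
  "mpoints Y = {p. length p = length Y \<and> (\<forall>i<length Y. p ! i \<in> proj_space (Y ! i))}"

definition subsets_of_card :: "mspace \<Rightarrow> nat \<Rightarrow> 'a::field mpoint set set" where
  "subsets_of_card Y r = {S. S \<subseteq> mpoints Y \<and> finite S \<and> card S = r}"

definition minimal_for :: "mspace \<Rightarrow> 'a::field mpoint set \<Rightarrow> bool" where
  "minimal_for Y S \<longleftrightarrow> (\<forall>i<length Y. proj_span (Y ! i) ((\<lambda>p. p ! i) ` S) = proj_space (Y ! i))"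


section \<open>Line bundles and double points on the standard affine charts\<close>

text \<open>
  A chart index \<open>J\<close> picks one homogeneous coordinate in each factor; its chart \<open>U_J\<close> is the affine
  open set where the coordinates \<open>x_{(i, J ! i)}\<close> are all nonzero. These charts cover \<open>Y\<close>.
  For a finite nonempty set \<open>W\<close> of chart indices we write \<open>U_W\<close> for the affine open set
  \<open>\<Inter>J\<in>W. U_J\<close>.
\<close>

definition charts :: "mspace \<Rightarrow> nat list set" where
  "charts Y = {J. length J = length Y \<and> (\<forall>i<length Y. J ! i \<le> Y ! i)}"

text \<open>
  Sections over all the \<open>U_W\<close> are elements of one common ring, that of Laurent polynomials in the
  homogeneous coordinates \<open>x_{(i, j)}\<close> (\<open>i < length Y\<close>, \<open>j \<le> Y ! i\<close>); restriction maps are inclusions.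
\<close>

type_synonym 'a laurent = "((nat \<times> nat) \<Rightarrow>\<^sub>0 int) \<Rightarrow>\<^sub>0 'a"

definition coords :: "mspace \<Rightarrow> (nat \<times> nat) set" where
  "coords Y = {(i, j). i < length Y \<and> j \<le> Y ! i}"

definition units_on :: "mspace \<Rightarrow> nat list set \<Rightarrow> (nat \<times> nat) set" where
  "units_on Y W = {(i, J ! i) | i J. i < length Y \<and> J \<in> W}"

text \<open>
  The sections of \<open>O_Y(d, \<dots>, d)\<close> over \<open>U_W\<close>: the part of multidegree \<open>(d, \<dots>, d)\<close> of the
  homogeneous coordinate ring of \<open>Y\<close> localised at the coordinates that are invertible on \<open>U_W\<close>.
\<close>

definition twist :: "mspace \<Rightarrow> int \<Rightarrow> nat list set \<Rightarrow> 'a::field laurent set" where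
  "twist Y d W = {f. \<forall>m \<in> Poly_Mapping.keys f.
     Poly_Mapping.keys m \<subseteq> coords Y \<and>
     (\<forall>v. Poly_Mapping.lookup m v < 0 \<longrightarrow> v \<in> units_on Y W) \<and>
     (\<forall>i<length Y. (\<Sum>j\<le>Y ! i. Poly_Mapping.lookup m (i, j)) = d)}"

text \<open>
  Evaluation at homogeneous coordinate vectors \<open>x\<close>. It is only applied where the coordinates with
  negative exponents are nonzero, so that \<open>0 powi k = 0\<close> for negative \<open>k\<close> plays no role.
\<close>

definition laurent_eval :: "'a::field laurent \<Rightarrow> 'a vec list \<Rightarrow> 'a" where
  "laurent_eval f x = (\<Sum>m \<in> Poly_Mapping.keys f. Poly_Mapping.lookup f m *
     (\<Prod>v \<in> Poly_Mapping.keys m. (x ! fst v $ snd v) powi Poly_Mapping.lookup m v))"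

definition lies_in :: "mspace \<Rightarrow> 'a::field mpoint \<Rightarrow> nat list set \<Rightarrow> bool" where
  "lies_in Y p W \<longleftrightarrow> (\<forall>J\<in>W. \<forall>i<length Y. \<forall>v \<in> p ! i. v $ (J ! i) \<noteq> 0)"

text \<open>
  The ideal of the point \<open>p\<close> in the coordinate ring \<open>twist Y 0 W\<close> of \<open>U_W\<close>; it is the unit ideal
  if \<open>p\<close> is not in \<open>U_W\<close>.
\<close>

definition point_ideal :: "mspace \<Rightarrow> 'a::field mpoint \<Rightarrow> nat list set \<Rightarrow> 'a laurent set" where
  "point_ideal Y p W =
     {f \<in> twist Y 0 W. lies_in Y p W \<longrightarrow> (\<forall>x. list_all2 (\<in>) x p \<longrightarrow> laurent_eval f x = 0)}"

definition set_product :: "'b::comm_ring_1 set \<Rightarrow> 'b set \<Rightarrow> 'b set" where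
  "set_product A B = {\<Sum>i<n. f i * g i | f g (n::nat). \<forall>i<n. f i \<in> A \<and> g i \<in> B}"

text \<open>
  Because \<open>U_W\<close> is affine, the sections over it of the square of the ideal sheaf of a point form the
  square of the ideal of its sections. The ideal of a union of subschemes is the intersection of
  their ideals.
\<close>

definition double_ideal :: "mspace \<Rightarrow> 'a::field mpoint set \<Rightarrow> nat list set \<Rightarrow> 'a laurent set" where
  "double_ideal Y S W =
     twist Y 0 W \<inter> (\<Inter>p\<in>S. set_product (point_ideal Y p W) (point_ideal Y p W))"

text \<open>
  The sections over \<open>U_W\<close> of \<open>I_{(2S,Y)}(1, \<dots>, 1) = I_{(2S,Y)} \<otimes> O_Y(1, \<dots>, 1)\<close>, as a subsheaf of
  the line bundle \<open>O_Y(1, \<dots>, 1)\<close>.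
\<close>

definition double_sheaf :: "mspace \<Rightarrow> 'a::field mpoint set \<Rightarrow> nat list set \<Rightarrow> 'a laurent set" where
  "double_sheaf Y S W = set_product (double_ideal Y S W) (twist Y 1 W)"


section \<open>Cohomology\<close>

text \<open>
  Cech cohomology for a cover indexed by \<open>I\<close>, of a sheaf whose sections over the intersection of
  the members of the cover in \<open>W\<close> are \<open>F W\<close>, a subspace of one fixed vector space, with inclusions as
  restriction maps. For quasi-coherent sheaves and the affine cover by the standard charts this is
  sheaf cohomology. Cochains are all (not only alternating) functions on tuples, set to zero
  outside the relevant tuples.
\<close>

definition tuples :: "'i set \<Rightarrow> nat \<Rightarrow> 'i list set" where
  "tuples I q = {js. length js = Suc q \<and> set js \<subseteq> I}"

definition cochains :: "'i set \<Rightarrow> ('i set \<Rightarrow> 'b::ab_group_add set) \<Rightarrow> nat \<Rightarrow> ('i list \<Rightarrow> 'b) set" where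
  "cochains I F q = {s. \<forall>js. if js \<in> tuples I q then s js \<in> F (set js) else s js = 0}"

definition differential ::
    "'i set \<Rightarrow> nat \<Rightarrow> ('i list \<Rightarrow> 'b::comm_ring_1) \<Rightarrow> ('i list \<Rightarrow> 'b)" where
  "differential I q s = (\<lambda>js. if js \<in> tuples I (Suc q)
     then \<Sum>l<length js. (-1) ^ l * s (take l js @ drop (Suc l) js) else 0)"

definition cocycles ::
    "'i set \<Rightarrow> ('i set \<Rightarrow> 'b::comm_ring_1 set) \<Rightarrow> nat \<Rightarrow> ('i list \<Rightarrow> 'b) set" where
  "cocycles I F q = {s \<in> cochains I F q. differential I q s = (\<lambda>_. 0)}"

fun coboundaries ::
    "'i set \<Rightarrow> ('i set \<Rightarrow> 'b::comm_ring_1 set) \<Rightarrow> nat \<Rightarrow> ('i list \<Rightarrow> 'b) set" where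
  "coboundaries I F 0 = {\<lambda>_. 0}"
| "coboundaries I F (Suc q) = differential I q ` cochains I F q"

text \<open>
  The dimension of the quotient \<open>Z / B\<close> of spaces of Laurent-polynomial-valued functions: the
  supremum of the cardinalities of finite subsets of \<open>Z\<close> that are linearly independent modulo \<open>B\<close>.
  It is \<open>\<infinity>\<close> if the quotient is infinite-dimensional.
\<close>

definition quotient_dim :: "('j \<Rightarrow> 'a::field laurent) set \<Rightarrow> ('j \<Rightarrow> 'a laurent) set \<Rightarrow> enat" where
  "quotient_dim Z B = Sup {enat (card A) | A. finite A \<and> A \<subseteq> Z \<and>
     (\<forall>c. (\<lambda>js. \<Sum>s\<in>A. Poly_Mapping.single 0 (c s) * s js) \<in> B \<longrightarrow> (\<forall>s\<in>A. c s = 0))}"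

definition cohomology_dim ::
    "mspace \<Rightarrow> (nat list set \<Rightarrow> 'a::field laurent set) \<Rightarrow> nat \<Rightarrow> enat" where
  "cohomology_dim Y F q = quotient_dim (cocycles (charts Y) F q) (coboundaries (charts Y) F q)"

definition delta :: "mspace \<Rightarrow> 'a::field mpoint set \<Rightarrow> enat" where
  "delta Y S = cohomology_dim Y (double_sheaf Y S) 1"


section \<open>Terracini sets\<close>

definition T1 :: "mspace \<Rightarrow> nat \<Rightarrow> 'a::field mpoint set set" where
  "T1 Y r = {S \<in> subsets_of_card Y r. cohomology_dim Y (double_sheaf Y S) 0 > 0 \<and> delta Y S > 0}"

definition T :: "mspace \<Rightarrow> nat \<Rightarrow> 'a::field mpoint set set" where
  "T Y r = {S \<in> T1 Y r. minimal_for Y S}"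

text \<open>
  Two multiprojective spaces are isomorphic iff the dimensions of their factors agree up to order,
  so sorted lists represent the isomorphism classes.
\<close>

definition E :: "nat \<Rightarrow> nat \<Rightarrow> (mspace \<times> 'a::field mpoint set) set" where
  "E n r = {(Y, S). multiprojective Y \<and> sorted Y \<and> sum_list Y = n \<and> S \<in> T Y r}"

end

theory Submission
  imports Defs
begin

text \<open>
  A form of multidegree \<open>(1, \<dots>, 1)\<close> vanishes doubly at a point iff its value and all its partial
  derivatives vanish there, and \<open>H^1(Y, O(1, \<dots>, 1)) = 0\<close>. Hence \<open>\<delta>(2S, Y) = 0\<close> iff every
  prescription of first-order jets at the points of \<open>S\<close> is attained by a global form.

  On a surface, \<open>P^2\<close> or \<open>P^1 \<times> P^1\<close>, no nonzero form is singular at two points. If \<open>S\<close> consists of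
  two points, minimality forces \<open>Y = (P^1)^n\<close> with the points different in every factor; for
  \<open>n \<ge> 3\<close> the products of linear forms of which all but one vanish at the second point realise all
  jets at the first point and have zero jet at the second.

  For \<open>n, r \<ge> 3\<close> take \<open>Y = (P^1)^n\<close> and write \<open>0 = (0 : 1)\<close>, \<open>\<infinity> = (1 : 0)\<close>. The points
  \<open>(\<infinity>, 0, 0, \<dots>, 0)\<close>, \<open>(0, \<infinity>, 0, \<dots>, 0)\<close> and \<open>(0, 0, (1 : t), \<dots>, (1 : t))\<close> for \<open>r - 2\<close> values
  of \<open>t\<close> have at least two factors equal to \<open>0\<close>, so \<open>\<Prod>i. x_{(i, 0)}\<close> is singular at all of them.
  The coefficient of \<open>\<Prod>i. x_{(i, 1)}\<close> in a form is a partial derivative at the first point and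
  also one at the second, so the jets at these two points cannot be prescribed independently.
\<close>

section \<open>Evaluation and partial derivatives of Laurent polynomials\<close>

text \<open>The ideal sheaf is given by honest squares of ideals in coordinate rings, so the jet
  criterion has to be derived. Elements of a squared ideal have zero jet by the Leibniz rule, over
  every \<open>U_W\<close> that contains the point. The converse rests on a Taylor expansion in the
  coordinate ring of one chart. It is applied only over single charts: for two points a 0-cochain is
  corrected, and the nontrivial cocycle for \<open>r \<ge> 3\<close> takes nonzero values only on
  overlaps that avoid \<open>S\<close>, where the ideal is the unit ideal. Jets consist of formal
  partial derivatives by the homogeneous coordinates in the common Laurent ring, so forms and local
  functions are treated alike.

  The dependence between the first two points is geometric. Under the Segre embedding the lines
  joining them to \<open>(0, \<dots>, 0)\<close> lie on \<open>(P^1)^n\<close>, so the image of this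
  point lies in both embedded tangent spaces. The remaining points make the other projections span
  and bring the cardinality to \<open>r\<close>.\<close>

definition lin_ext :: "('b \<Rightarrow> 'a::comm_ring_1) \<Rightarrow> ('b \<Rightarrow>\<^sub>0 'a) \<Rightarrow> 'a" where
  "lin_ext \<phi> f = (\<Sum>m\<in>Poly_Mapping.keys f. Poly_Mapping.lookup f m * \<phi> m)"

lemma lin_superset:
  assumes "finite K" "Poly_Mapping.keys f \<subseteq> K"
  shows "lin_ext \<phi> f = (\<Sum>m\<in>K. Poly_Mapping.lookup f m * \<phi> m)"
  unfolding lin_ext_def using assms
  by (intro sum.mono_neutral_left) (auto simp: in_keys_iff)

lemma lin_zero [simp]: "lin_ext \<phi> 0 = 0"
  by (simp add: lin_ext_def)

lemma lin_single [simp]: "lin_ext \<phi> (Poly_Mapping.single m c) = c * \<phi> m"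
  by (simp add: lin_ext_def)

lemma lin_add: "lin_ext \<phi> (f + g) = lin_ext \<phi> f + lin_ext \<phi> g"
proof -
  let ?K = "Poly_Mapping.keys f \<union> Poly_Mapping.keys g"
  have "lin_ext \<phi> (f + g) = (\<Sum>m\<in>?K. Poly_Mapping.lookup (f + g) m * \<phi> m)"
    by (rule lin_superset) (simp_all add: keys_add)
  also have "\<dots> = lin_ext \<phi> f + lin_ext \<phi> g"
    unfolding lin_superset[of ?K f \<phi>, OF _ Un_upper1, simplified]
      lin_superset[of ?K g \<phi>, OF _ Un_upper2, simplified]
    by (simp only: lookup_add distrib_right sum.distrib)
  finally show ?thesis .
qed

lemma lin_uminus: "lin_ext \<phi> (- f) = - lin_ext \<phi> f"
  using lin_add[of \<phi> f "- f"] by (metis add.right_inverse lin_zero minus_unique)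

lemma lin_diff: "lin_ext \<phi> (f - g) = lin_ext \<phi> f - lin_ext \<phi> g"
  using lin_add[of \<phi> f "- g"] by (simp add: lin_uminus)

lemma lin_sum: "lin_ext \<phi> (\<Sum>i\<in>A. f i) = (\<Sum>i\<in>A. lin_ext \<phi> (f i))"
  by (induction A rule: infinite_finite_induct) (auto simp: lin_add)

lemma poly_mapping_monomials:
  "f = (\<Sum>m\<in>Poly_Mapping.keys f. Poly_Mapping.single m (Poly_Mapping.lookup f m))"
proof (rule poly_mapping_eqI)
  fix k
  show "Poly_Mapping.lookup f k =
    Poly_Mapping.lookup (\<Sum>m\<in>Poly_Mapping.keys f. Poly_Mapping.single m (Poly_Mapping.lookup f m)) k"
    by (simp add: lookup_sum lookup_single when_def in_keys_iff)
qed

text \<open>Cancellation may remove monomials from \<open>f * g\<close>, so the sum runs over pairs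
  of monomials of the factors. It reduces product rules for \<open>ev\<close> and \<open>der\<close>
  to single exponents.\<close>

lemma lin_mult:
  fixes f g :: "'b::comm_monoid_add \<Rightarrow>\<^sub>0 'a::comm_ring_1"
  shows "lin_ext \<phi> (f * g) = (\<Sum>m\<in>Poly_Mapping.keys f. \<Sum>k\<in>Poly_Mapping.keys g.
     Poly_Mapping.lookup f m * Poly_Mapping.lookup g k * \<phi> (m + k))"
proof -
  have "f * g = (\<Sum>m\<in>Poly_Mapping.keys f. Poly_Mapping.single m (Poly_Mapping.lookup f m)) *
     (\<Sum>k\<in>Poly_Mapping.keys g. Poly_Mapping.single k (Poly_Mapping.lookup g k))"
    by (rule arg_cong2[where f = "(*)", OF poly_mapping_monomials poly_mapping_monomials])
  also have "\<dots> = (\<Sum>m\<in>Poly_Mapping.keys f. \<Sum>k\<in>Poly_Mapping.keys g.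
     Poly_Mapping.single (m + k) (Poly_Mapping.lookup f m * Poly_Mapping.lookup g k))"
    by (simp only: sum_product mult_single)
  also have "lin_ext \<phi> \<dots> = (\<Sum>m\<in>Poly_Mapping.keys f. \<Sum>k\<in>Poly_Mapping.keys g.
     Poly_Mapping.lookup f m * Poly_Mapping.lookup g k * \<phi> (m + k))"
    by (simp only: lin_sum lin_single)
  finally show ?thesis .
qed

type_synonym exponent = "(nat \<times> nat) \<Rightarrow>\<^sub>0 int"

definition mon :: "(nat \<times> nat \<Rightarrow> 'a::field) \<Rightarrow> exponent \<Rightarrow> 'a" where
  "mon x m = (\<Prod>v\<in>Poly_Mapping.keys m. x v powi Poly_Mapping.lookup m v)"

text \<open>The cofactor of the variable \<open>w\<close>. Keeping it apart gives the derivative by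
  \<open>w\<close> without dividing by \<open>x w\<close>, which may be zero.\<close>

definition mon_but :: "(nat \<times> nat \<Rightarrow> 'a::field) \<Rightarrow> nat \<times> nat \<Rightarrow> exponent \<Rightarrow> 'a" where
  "mon_but x w m = (\<Prod>v\<in>Poly_Mapping.keys m - {w}. x v powi Poly_Mapping.lookup m v)"

text \<open>The partial derivative of a monomial by the variable \<open>w\<close>, at
  \<open>x\<close>. For exponent \<open>0\<close> the power has exponent \<open>-1\<close>, and the
  factor \<open>of_int 0\<close> removes it.\<close>

definition dmon :: "(nat \<times> nat \<Rightarrow> 'a::field) \<Rightarrow> nat \<times> nat \<Rightarrow> exponent \<Rightarrow> 'a" where
  "dmon x w m = of_int (Poly_Mapping.lookup m w) * x w powi (Poly_Mapping.lookup m w - 1) * mon_but x w m"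

definition ev :: "(nat \<times> nat \<Rightarrow> 'a::field) \<Rightarrow> 'a laurent \<Rightarrow> 'a" where
  "ev x = lin_ext (mon x)"

definition der :: "(nat \<times> nat \<Rightarrow> 'a::field) \<Rightarrow> nat \<times> nat \<Rightarrow> 'a laurent \<Rightarrow> 'a" where
  "der x w = lin_ext (dmon x w)"

text \<open>The monomial has no pole at \<open>x\<close>. Without this, multiplicativity fails:
  \<open>0 powi 1 * 0 powi (-1)\<close> is \<open>0\<close>, but \<open>0 powi 0\<close> is
  \<open>1\<close>.\<close>

definition regular_expo :: "(nat \<times> nat \<Rightarrow> 'a::field) \<Rightarrow> exponent \<Rightarrow> bool" where
  "regular_expo x m \<longleftrightarrow> (\<forall>v. Poly_Mapping.lookup m v < 0 \<longrightarrow> x v \<noteq> 0)"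

definition regular_at :: "(nat \<times> nat \<Rightarrow> 'a::field) \<Rightarrow> 'a laurent set" where
  "regular_at x = {f. \<forall>m\<in>Poly_Mapping.keys f. regular_expo x m}"

lemma mon_but_superset:
  assumes "finite K" "Poly_Mapping.keys m \<subseteq> K"
  shows "mon_but x w m = (\<Prod>v\<in>K - {w}. x v powi Poly_Mapping.lookup m v)"
  unfolding mon_but_def using assms
  by (intro prod.mono_neutral_left) (auto simp: in_keys_iff)

lemma mon_split: "mon x m = x w powi Poly_Mapping.lookup m w * mon_but x w m"
proof -
  let ?K = "insert w (Poly_Mapping.keys m)"
  have "mon x m = (\<Prod>v\<in>?K. x v powi Poly_Mapping.lookup m v)"
    unfolding mon_def by (intro prod.mono_neutral_left) (auto simp: in_keys_iff)
  also have "\<dots> = x w powi Poly_Mapping.lookup m w * mon_but x w m"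
    by (subst prod.remove[of _ w]) (auto simp: mon_but_def)
  finally show ?thesis .
qed

lemma powi_add_good:
  fixes x :: "'a::field"
  assumes "a < 0 \<longrightarrow> x \<noteq> 0" "b < 0 \<longrightarrow> x \<noteq> 0"
  shows "x powi (a + b) = x powi a * x powi b"
  using assms by (cases "x = 0") (auto simp: power_int_add power_int_0_left_if)

text \<open>The Leibniz rule for powers of one variable, to which the rule for monomials reduces
  through \<open>mon_but\<close>.\<close>

lemma dpowi_add_good:
  fixes x :: "'a::field"
  assumes "a < 0 \<longrightarrow> x \<noteq> 0" "b < 0 \<longrightarrow> x \<noteq> 0"
  shows "of_int (a + b) * x powi (a + b - 1) =
    of_int a * x powi (a - 1) * x powi b + x powi a * (of_int b * x powi (b - 1))"
proof (cases "x = 0")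
  case True
  \<comment> \<open>At \<open>x = 0\<close> both exponents are nonnegative, and both sides are
    \<open>1\<close> if \<open>a + b = 1\<close> and \<open>0\<close> otherwise.\<close>
  then show ?thesis using assms by (auto simp: power_int_0_left_if)
next
  case False
  then have "x powi (a + b - 1) = x powi a * x powi b / x"
    "x powi (a - 1) = x powi a / x" "x powi (b - 1) = x powi b / x"
    by (simp_all add: power_int_add power_int_diff)
  then show ?thesis by (simp add: algebra_simps add_divide_distrib)
qed

lemma goodD: "regular_expo x m \<Longrightarrow> Poly_Mapping.lookup m v < 0 \<longrightarrow> x v \<noteq> 0"
  by (cases v) (auto simp: regular_expo_def)

lemma mon_but_add:
  assumes "regular_expo x m" "regular_expo x k"
  shows "mon_but x w (m + k) = mon_but x w m * mon_but x w k"
proof -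
  let ?K = "Poly_Mapping.keys m \<union> Poly_Mapping.keys k"
  have "mon_but x w (m + k) = (\<Prod>v\<in>?K - {w}. x v powi Poly_Mapping.lookup (m + k) v)"
    by (rule mon_but_superset) (simp_all add: keys_add)
  also have "\<dots> = (\<Prod>v\<in>?K - {w}. x v powi Poly_Mapping.lookup m v * x v powi Poly_Mapping.lookup k v)"
    unfolding lookup_add using assms by (intro prod.cong refl powi_add_good goodD)
  also have "\<dots> = mon_but x w m * mon_but x w k"
    by (simp only: prod.distrib mon_but_superset[of ?K m, OF finite_UnI[OF finite_keys finite_keys] Un_upper1]
        mon_but_superset[of ?K k, OF finite_UnI[OF finite_keys finite_keys] Un_upper2])
  finally show ?thesis .
qed

lemma mon_add:
  assumes "regular_expo x m" "regular_expo x k"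
  shows "mon x (m + k) = mon x m * mon x k"
  using powi_add_good[OF goodD[OF assms(1)] goodD[OF assms(2)], of undefined] assms
  by (simp add: mon_split[of x _ undefined] mon_but_add lookup_add)

lemma dmon_add:
  assumes "regular_expo x m" "regular_expo x k"
  shows "dmon x w (m + k) = dmon x w m * mon x k + mon x m * dmon x w k"
proof -
  have "dmon x w (m + k) = (of_int (Poly_Mapping.lookup m w + Poly_Mapping.lookup k w) *
      x w powi (Poly_Mapping.lookup m w + Poly_Mapping.lookup k w - 1)) * (mon_but x w m * mon_but x w k)"
    using assms by (simp add: dmon_def mon_but_add lookup_add)
  also note dpowi_add_good[OF goodD[OF assms(1)] goodD[OF assms(2)], of w]
  finally show ?thesis by (simp add: dmon_def mon_split[of x _ w] algebra_simps)
qed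

lemma good_add: "regular_expo x m \<Longrightarrow> regular_expo x k \<Longrightarrow> regular_expo x (m + k)"
  unfolding regular_expo_def lookup_add by (metis add_nonneg_nonneg not_less)

lemma reg_mult: "f \<in> regular_at x \<Longrightarrow> g \<in> regular_at x \<Longrightarrow> f * g \<in> regular_at x"
  unfolding regular_at_def by (auto dest!: set_mp[OF keys_mult] simp: good_add)

lemma reg_add: "f \<in> regular_at x \<Longrightarrow> g \<in> regular_at x \<Longrightarrow> f + g \<in> regular_at x"
  unfolding regular_at_def by (auto dest!: set_mp[OF keys_add])

lemma reg_0 [simp]: "0 \<in> regular_at x" by (simp add: regular_at_def)

lemma ev_mult:
  assumes "f \<in> regular_at x" "g \<in> regular_at x"
  shows "ev x (f * g) = ev x f * ev x g"
proof -
  have "ev x (f * g) = (\<Sum>m\<in>Poly_Mapping.keys f. \<Sum>k\<in>Poly_Mapping.keys g.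
      (Poly_Mapping.lookup f m * mon x m) * (Poly_Mapping.lookup g k * mon x k))"
    unfolding ev_def lin_mult using assms
    by (intro sum.cong refl) (simp add: regular_at_def mon_add)
  then show ?thesis
    by (simp add: ev_def lin_ext_def sum_product)
qed

lemma der_mult:
  assumes "f \<in> regular_at x" "g \<in> regular_at x"
  shows "der x w (f * g) = der x w f * ev x g + ev x f * der x w g"
proof -
  have "der x w (f * g) = (\<Sum>m\<in>Poly_Mapping.keys f. \<Sum>k\<in>Poly_Mapping.keys g.
      (Poly_Mapping.lookup f m * dmon x w m) * (Poly_Mapping.lookup g k * mon x k) +
      (Poly_Mapping.lookup f m * mon x m) * (Poly_Mapping.lookup g k * dmon x w k))"
    unfolding der_def lin_mult using assms
    by (intro sum.cong refl) (simp add: regular_at_def dmon_add algebra_simps)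
  then show ?thesis
    by (simp add: der_def ev_def lin_ext_def sum_product sum.distrib)
qed

lemma ev_linear:
  "ev x (f + g) = ev x f + ev x g" "ev x (f - g) = ev x f - ev x g" "ev x (- f) = - ev x f"
  "ev x (sum h A) = (\<Sum>i\<in>A. ev x (h i))" "ev x 0 = 0" "ev x (Poly_Mapping.single m c) = c * mon x m"
  by (simp_all add: ev_def lin_add lin_diff lin_uminus lin_sum)

lemma der_linear:
  "der x w (f + g) = der x w f + der x w g" "der x w (f - g) = der x w f - der x w g"
  "der x w (- f) = - der x w f" "der x w (sum h A) = (\<Sum>i\<in>A. der x w (h i))" "der x w 0 = 0"
  "der x w (Poly_Mapping.single m c) = c * dmon x w m"
  by (simp_all add: der_def lin_add lin_diff lin_uminus lin_sum)

lemma laurent_eval_ev: "laurent_eval f x = ev (\<lambda>v. x ! fst v $ snd v) f"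
  by (simp add: laurent_eval_def ev_def lin_ext_def mon_def)

section \<open>Twists and ideals of points\<close>

text \<open>The admissible exponents of \<open>twist\<close>: since \<open>twist Y d W\<close> is
  spanned by monomials, membership can be tested on each exponent separately.\<close>

definition tmon :: "mspace \<Rightarrow> int \<Rightarrow> nat list set \<Rightarrow> exponent set" where
  "tmon Y d W = {m. Poly_Mapping.keys m \<subseteq> coords Y \<and>
     (\<forall>v. Poly_Mapping.lookup m v < 0 \<longrightarrow> v \<in> units_on Y W) \<and>
     (\<forall>i<length Y. (\<Sum>j\<le>Y ! i. Poly_Mapping.lookup m (i, j)) = d)}"

lemma tmonD:
  assumes "m \<in> tmon Y d W"
  shows "Poly_Mapping.keys m \<subseteq> coords Y"
    "Poly_Mapping.lookup m v < 0 \<Longrightarrow> v \<in> units_on Y W"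
    "i < length Y \<Longrightarrow> (\<Sum>j\<le>Y ! i. Poly_Mapping.lookup m (i, j)) = d"
  using assms unfolding tmon_def by blast+

lemma twist_iff: "f \<in> twist Y d W \<longleftrightarrow> Poly_Mapping.keys f \<subseteq> tmon Y d W"
  unfolding twist_def tmon_def by blast

lemma tmon_add:
  assumes "m \<in> tmon Y d W" "k \<in> tmon Y e W"
  shows "m + k \<in> tmon Y (d + e) W"
proof -
  have "Poly_Mapping.keys (m + k) \<subseteq> coords Y"
    using assms keys_add[of m k] unfolding tmon_def by blast
  moreover have "v \<in> units_on Y W" if "Poly_Mapping.lookup (m + k) v < 0" for v
  proof -
    have "Poly_Mapping.lookup m v < 0 \<or> Poly_Mapping.lookup k v < 0"
      using that unfolding lookup_add by linarith
    then show ?thesis using assms unfolding tmon_def by blast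
  qed
  ultimately show ?thesis
    using assms unfolding tmon_def by (simp add: lookup_add sum.distrib)
qed

lemma tmon_mono: "W \<subseteq> W' \<Longrightarrow> tmon Y d W \<subseteq> tmon Y d W'"
  unfolding tmon_def units_on_def by blast

lemma twist_mono: "W \<subseteq> W' \<Longrightarrow> twist Y d W \<subseteq> twist Y d W'"
  unfolding twist_iff[abs_def] subset_iff using tmon_mono[of W W' Y d] by blast

lemma twist_add: "f \<in> twist Y d W \<Longrightarrow> g \<in> twist Y d W \<Longrightarrow> f + g \<in> twist Y d W"
  unfolding twist_iff using keys_add[of f g] by blast

lemma twist_0 [simp]: "0 \<in> twist Y d W"
  by (simp add: twist_iff)

lemma twist_mult: "f \<in> twist Y d W \<Longrightarrow> g \<in> twist Y e W \<Longrightarrow> f * g \<in> twist Y (d + e) W"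
  unfolding twist_iff using keys_mult[of f g] by (blast intro: tmon_add)

lemma twist_single: "m \<in> tmon Y d W \<Longrightarrow> Poly_Mapping.single m c \<in> twist Y d W"
  by (simp add: twist_iff)

lemma twist_const [simp]: "Poly_Mapping.single 0 c \<in> twist Y 0 W"
  by (simp add: twist_iff tmon_def)

lemma twist_scale: "f \<in> twist Y d W \<Longrightarrow> Poly_Mapping.single 0 c * f \<in> twist Y d W"
  using twist_mult[OF twist_const] by fastforce

lemma twist_1 [simp]: "1 \<in> twist Y 0 W"
  using twist_const[of 1] by simp

lemma keys_uminus: "Poly_Mapping.keys (- f) = Poly_Mapping.keys f"
  by (auto simp: in_keys_iff)

lemma twist_uminus: "f \<in> twist Y d W \<Longrightarrow> - f \<in> twist Y d W"
  by (simp add: twist_iff keys_uminus)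

lemma twist_diff: "f \<in> twist Y d W \<Longrightarrow> g \<in> twist Y d W \<Longrightarrow> f - g \<in> twist Y d W"
  using twist_add[of f Y d W "- g"] by (simp add: twist_uminus)

section \<open>Representatives of points by homogeneous coordinate vectors\<close>

abbreviation coord_at :: "'a vec list \<Rightarrow> nat \<times> nat \<Rightarrow> 'a" where
  "coord_at xs v \<equiv> xs ! fst v $ snd v"

lemma rep_exists:
  assumes "p \<in> mpoints Y"
  shows "\<exists>xs. list_all2 (\<in>) xs p"
proof -
  have ex: "\<exists>x. x \<in> p ! i" if "i < length p" for i
  proof -
    have "p ! i \<in> proj_space (Y ! i)" using assms that unfolding mpoints_def by simp
    then obtain v where "p ! i = {c \<cdot>\<^sub>v v | c. c \<noteq> 0}" unfolding proj_space_def by blast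
    moreover have "1 \<cdot>\<^sub>v v \<in> {c \<cdot>\<^sub>v v | c. c \<noteq> 0}"
      by (intro CollectI exI[of _ 1]) simp
    ultimately show ?thesis by blast
  qed
  have "list_all2 (\<in>) (map (\<lambda>i. SOME x. x \<in> p ! i) [0..<length p]) p"
    by (rule list_all2_all_nthI) (simp_all add: someI_ex[OF ex])
  then show ?thesis by blast
qed

lemma rep_vec:
  assumes "p \<in> mpoints Y" "list_all2 (\<in>) xs p" "i < length Y"
  shows "xs ! i \<in> p ! i" "xs ! i \<in> carrier_vec (Suc (Y ! i))" "xs ! i \<noteq> 0\<^sub>v (Suc (Y ! i))"
    "p ! i = {c \<cdot>\<^sub>v (xs ! i) | c. c \<noteq> 0}"
proof -
  have l: "length p = length Y" "p ! i \<in> proj_space (Y ! i)"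
    using assms by (auto simp: mpoints_def)
  show x: "xs ! i \<in> p ! i" using assms l by (auto simp: list_all2_conv_all_nth)
  obtain v where v: "p ! i = {c \<cdot>\<^sub>v v | c. c \<noteq> 0}" "v \<in> carrier_vec (Suc (Y ! i))" "v \<noteq> 0\<^sub>v (Suc (Y ! i))"
    using l(2) by (auto simp: proj_space_def)
  with x obtain c where c: "c \<noteq> 0" "xs ! i = c \<cdot>\<^sub>v v" by auto
  show "xs ! i \<in> carrier_vec (Suc (Y ! i))" using c v by simp
  have vx: "v = inverse c \<cdot>\<^sub>v (xs ! i)" unfolding c(2) smult_smult_assoc using c(1) by simp
  show "xs ! i \<noteq> 0\<^sub>v (Suc (Y ! i))" 
  proof
    assume "xs ! i = 0\<^sub>v (Suc (Y ! i))"
    with vx have "v = inverse c \<cdot>\<^sub>v 0\<^sub>v (Suc (Y ! i))" by simp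
    also have "\<dots> = 0\<^sub>v (Suc (Y ! i))" by (intro eq_vecI) auto
    finally show False using v(3) by simp
  qed
  show "p ! i = {c \<cdot>\<^sub>v (xs ! i) | c. c \<noteq> 0}"
  proof (intro Set.set_eqI iffI)
    fix y assume "y \<in> p ! i"
    then obtain d where "d \<noteq> 0" "y = d \<cdot>\<^sub>v v" using v by auto
    then have "y = (d * inverse c) \<cdot>\<^sub>v (xs ! i)" "d * inverse c \<noteq> 0"
      using c(1) arg_cong[OF vx, of "(\<cdot>\<^sub>v) d"] by (simp_all add: smult_smult_assoc)
    then show "y \<in> {c \<cdot>\<^sub>v (xs ! i) | c. c \<noteq> 0}" by blast
  next
    fix y assume "y \<in> {c \<cdot>\<^sub>v (xs ! i) | c. c \<noteq> 0}"
    then obtain d where "d \<noteq> 0" "y = d \<cdot>\<^sub>v (xs ! i)" by auto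
    then have "y = (d * c) \<cdot>\<^sub>v v" "d * c \<noteq> 0" using c by (auto simp: smult_smult_assoc)
    then show "y \<in> p ! i" using v by blast
  qed
qed

lemma rep_scale:
  assumes "p \<in> mpoints Y" "list_all2 (\<in>) xs p" "list_all2 (\<in>) ys p" "i < length Y"
  obtains c where "c \<noteq> 0" "ys ! i = c \<cdot>\<^sub>v (xs ! i)"
  using rep_vec(4)[OF assms(1,2,4)] rep_vec(1)[OF assms(1,3,4)] by auto

text \<open>Nonvanishing of a coordinate is invariant under nonzero scaling, so one representative
  decides. Membership in \<open>charts Y\<close> keeps the coordinate index within the dimension of
  the vector.\<close>

lemma lies_in_rep:
  assumes "p \<in> mpoints Y" "list_all2 (\<in>) xs p" "W \<subseteq> charts Y"
  shows "lies_in Y p W \<longleftrightarrow> (\<forall>J\<in>W. \<forall>i<length Y. xs ! i $ (J ! i) \<noteq> 0)"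
proof
  assume "lies_in Y p W"
  then show "\<forall>J\<in>W. \<forall>i<length Y. xs ! i $ (J ! i) \<noteq> 0"
    using rep_vec(1)[OF assms(1,2)] by (auto simp: lies_in_def)
next
  assume *: "\<forall>J\<in>W. \<forall>i<length Y. xs ! i $ (J ! i) \<noteq> 0"
  show "lies_in Y p W" unfolding lies_in_def
  proof (intro ballI allI impI)
    fix J i v assume J: "J \<in> W" and i: "i < length Y" and v: "v \<in> p ! i"
    obtain c where c: "c \<noteq> 0" "v = c \<cdot>\<^sub>v (xs ! i)"
      using v rep_vec(4)[OF assms(1,2) i] by auto
    moreover have "J ! i < dim_vec (xs ! i)"
      using rep_vec(2)[OF assms(1,2) i] J i assms(3) by (auto simp: charts_def less_Suc_eq_le)
    ultimately show "v $ (J ! i) \<noteq> 0" using * J i by simp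
  qed
qed

text \<open>Negative exponents occur only at coordinates invertible on \<open>U_W\<close>, and those
  are nonzero at a point of \<open>U_W\<close>.\<close>

lemma reg_twist:
  assumes "p \<in> mpoints Y" "list_all2 (\<in>) xs p" "lies_in Y p W" "f \<in> twist Y d W"
  shows "f \<in> regular_at (coord_at xs)"
  unfolding regular_at_def regular_expo_def
proof (intro CollectI ballI allI impI)
  fix m v assume "m \<in> Poly_Mapping.keys f" "Poly_Mapping.lookup m v < 0"
  then have "v \<in> units_on Y W" using assms(4) unfolding twist_def by blast
  then obtain i J where "v = (i, J ! i)" "i < length Y" "J \<in> W" by (auto simp: units_on_def)
  then show "coord_at xs v \<noteq> 0" using assms(3) rep_vec(1)[OF assms(1,2)] by (auto simp: lies_in_def)
qed

section \<open>Products of ideals and the easy half of the jet criterion\<close>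

lemma set_product_induct [consumes 1, case_names zero add mult]:
  assumes "x \<in> set_product A B" "P 0" "\<And>x y. P x \<Longrightarrow> P y \<Longrightarrow> P (x + y)"
    "\<And>a b. a \<in> A \<Longrightarrow> b \<in> B \<Longrightarrow> P (a * b)"
  shows "P x"
proof -
  obtain f g n where x: "x = (\<Sum>i<(n::nat). f i * g i)" "\<forall>i<n. f i \<in> A \<and> g i \<in> B"
    using assms(1) by (auto simp: set_product_def)
  have "P (\<Sum>i<k. f i * g i)" if "k \<le> n" for k
    using that by (induction k) (use assms x(2) in auto)
  then show ?thesis using x(1) by simp
qed

lemma set_product_mult: "a \<in> A \<Longrightarrow> b \<in> B \<Longrightarrow> a * b \<in> set_product A B"
  unfolding set_product_def
  by (rule CollectI, rule exI[of _ "\<lambda>_. a"], rule exI[of _ "\<lambda>_. b"], rule exI[of _ "1::nat"]) simp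

lemma set_product_0 [simp]: "0 \<in> set_product A B"
  unfolding set_product_def
  by (rule CollectI, rule exI[of _ "\<lambda>_. 0"], rule exI[of _ "\<lambda>_. 0"], rule exI[of _ "0::nat"]) simp

lemma set_product_add:
  assumes "x \<in> set_product A B" "y \<in> set_product A B"
  shows "x + y \<in> set_product A B"
proof -
  obtain f g n where x: "x = (\<Sum>i<(n::nat). f i * g i)" "\<forall>i<n. f i \<in> A \<and> g i \<in> B"
    using assms(1) by (auto simp: set_product_def)
  obtain f' g' n' where y: "y = (\<Sum>i<(n'::nat). f' i * g' i)" "\<forall>i<n'. f' i \<in> A \<and> g' i \<in> B"
    using assms(2) by (auto simp: set_product_def)
  \<comment> \<open>The two families of summands are concatenated, the second one shifted by
    \<open>n\<close>.\<close>
  let ?f = "\<lambda>i. if i < n then f i else f' (i - n)" and ?g = "\<lambda>i. if i < n then g i else g' (i - n)"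
  have "(\<Sum>i<n + k. ?f i * ?g i) = x + (\<Sum>i<k. f' i * g' i)" for k
  proof (induction k)
    case 0
    show ?case unfolding x(1) by (auto intro: sum.cong)
  next
    case (Suc k)
    then show ?case by (simp add: add.assoc)
  qed
  then have "x + y = (\<Sum>i<n + n'. ?f i * ?g i)" using y by simp
  moreover have "\<forall>i<n + n'. ?f i \<in> A \<and> ?g i \<in> B" using x y by auto
  ultimately show ?thesis unfolding set_product_def
    by (intro CollectI exI[of _ ?f] exI[of _ ?g] exI[of _ "n + n'"] conjI)
qed

lemma set_product_sum: "(\<And>i. i \<in> I \<Longrightarrow> f i \<in> set_product A B) \<Longrightarrow> sum f I \<in> set_product A B"
  by (induction I rule: infinite_finite_induct) (auto intro: set_product_add)

lemma set_product_scale: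
  assumes "\<And>a. a \<in> A \<Longrightarrow> r * a \<in> A" "x \<in> set_product A B"
  shows "r * x \<in> set_product A B"
  using assms(2)
proof (induction rule: set_product_induct)
  case (add x y)
  then show ?case by (simp add: distrib_left set_product_add)
next
  case (mult a b)
  then show ?case using set_product_mult[OF assms(1)[OF mult(1)] mult(2)] by (simp add: mult.assoc)
qed simp

lemma point_ideal_twist: "f \<in> point_ideal Y p W \<Longrightarrow> f \<in> twist Y 0 W"
  by (simp add: point_ideal_def)

lemma point_ideal_mult:
  assumes "p \<in> mpoints Y" "f \<in> point_ideal Y p W" "g \<in> twist Y 0 W"
  shows "g * f \<in> point_ideal Y p W"
proof -
  have "g * f \<in> twist Y 0 W" using twist_mult[of g Y 0 W f 0] assms by (simp add: point_ideal_def)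
  moreover have "laurent_eval (g * f) x = 0" if "lies_in Y p W" "list_all2 (\<in>) x p" for x
  proof -
    have "f \<in> regular_at (coord_at x)" "g \<in> regular_at (coord_at x)"
      using assms reg_twist[OF assms(1) that(2,1), of _ 0] by (auto simp: point_ideal_def)
    moreover have "ev (coord_at x) f = 0"
      using assms(2) that by (simp add: point_ideal_def laurent_eval_ev)
    ultimately show ?thesis by (simp add: laurent_eval_ev ev_mult)
  qed
  ultimately show ?thesis by (simp add: point_ideal_def)
qed

abbreviation sq_ideal :: "mspace \<Rightarrow> 'a::field mpoint \<Rightarrow> nat list set \<Rightarrow> 'a laurent set" where
  "sq_ideal Y p W \<equiv> set_product (point_ideal Y p W) (point_ideal Y p W)"

lemma sq_ideal_mult:
  assumes "p \<in> mpoints Y" "f \<in> sq_ideal Y p W" "g \<in> twist Y 0 W"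
  shows "g * f \<in> sq_ideal Y p W"
  by (rule set_product_scale[OF point_ideal_mult[OF assms(1) _ assms(3)] assms(2)])

text \<open>Every term of the derivative of \<open>a * b\<close> keeps one factor that vanishes at
  the point. Regularity is carried along because the product rules ask for it when such an element
  is multiplied further.\<close>

lemma sq_ideal_jet:
  assumes p: "p \<in> mpoints Y" "list_all2 (\<in>) xs p" "lies_in Y p W" and f: "f \<in> sq_ideal Y p W"
  shows "f \<in> regular_at (coord_at xs) \<and> ev (coord_at xs) f = 0 \<and> der (coord_at xs) v f = 0"
  using f
proof (induction rule: set_product_induct)
  case (add x y)
  then show ?case by (simp add: reg_add ev_linear der_linear)
next
  case (mult a b)
  have r: "a \<in> regular_at (coord_at xs)" "b \<in> regular_at (coord_at xs)"
    using mult reg_twist[OF p, of _ 0] by (auto simp: point_ideal_def)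
  moreover have "ev (coord_at xs) a = 0" "ev (coord_at xs) b = 0"
    using mult p by (auto simp: point_ideal_def laurent_eval_ev)
  ultimately show ?case by (simp add: reg_mult ev_mult der_mult)
qed (simp add: ev_linear der_linear)

text \<open>A zero jet stays zero after multiplication by any regular section of the line bundle.
  The statement covers all \<open>W\<close>, so it applies to cocycles on overlaps of two
  charts.\<close>

lemma double_sheaf_jet:
  assumes p: "p \<in> mpoints Y" "list_all2 (\<in>) xs p" "lies_in Y p W" "p \<in> S" and f: "f \<in> double_sheaf Y S W"
  shows "f \<in> regular_at (coord_at xs) \<and> ev (coord_at xs) f = 0 \<and> der (coord_at xs) v f = 0"
  using f unfolding double_sheaf_def
proof (induction rule: set_product_induct)
  case (add x y)
  then show ?case by (simp add: reg_add ev_linear der_linear)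
next
  case (mult a b)
  have "a \<in> sq_ideal Y p W" using mult p by (auto simp: double_ideal_def)
  from sq_ideal_jet[OF p(1-3) this, of v] reg_twist[OF p(1-3) mult(2)]
  show ?case by (simp add: reg_mult ev_mult der_mult)
qed (simp add: ev_linear der_linear)

lemma double_sheaf_twist: "f \<in> double_sheaf Y S W \<Longrightarrow> f \<in> twist Y 1 W"
  unfolding double_sheaf_def
proof (induction rule: set_product_induct)
  case (mult a b)
  then show ?case using twist_mult[of a Y 0 W b 1] by (simp add: double_ideal_def)
qed (auto intro: twist_add)

section \<open>First-order Taylor expansion at a point of a chart\<close>

text \<open>The exponent of the affine coordinate \<open>x_v / x_{(fst v, J ! fst v)}\<close> on the
  chart \<open>J\<close>; it is \<open>0\<close> if \<open>v\<close> is itself the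
  denominator.\<close>

definition chart_expo :: "nat list \<Rightarrow> nat \<times> nat \<Rightarrow> exponent" where
  "chart_expo J v = Poly_Mapping.single v 1 - Poly_Mapping.single (fst v, J ! fst v) 1"

definition chart_coord :: "nat list \<Rightarrow> nat \<times> nat \<Rightarrow> 'a::field laurent" where
  "chart_coord J v = Poly_Mapping.single (chart_expo J v) 1"

definition affine_coords :: "mspace \<Rightarrow> nat list \<Rightarrow> (nat \<times> nat) set" where
  "affine_coords Y J = {v \<in> coords Y. snd v \<noteq> J ! fst v}"

lemma finite_coords: "finite (coords Y)"
proof -
  have "coords Y = (SIGMA i:{..<length Y}. {..Y ! i})" by (auto simp: coords_def)
  then show ?thesis by simp
qed

lemma finite_affine_coords [simp]: "finite (affine_coords Y J)"
  unfolding affine_coords_def by (simp add: finite_coords)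

lemma lookup_chart_expo:
  "Poly_Mapping.lookup (chart_expo J v) w =
     (if w = v then 1 else 0) - (if w = (fst v, J ! fst v) then 1 else 0)"
  by (simp add: chart_expo_def lookup_minus lookup_single when_def eq_commute)

lemma keys_chart_expo: "Poly_Mapping.keys (chart_expo J v) \<subseteq> {v, (fst v, J ! fst v)}"
  by (auto simp: in_keys_iff lookup_chart_expo split: if_splits)

lemma keys_chart_expo_affine:
  assumes "v \<in> affine_coords Y J"
  shows "Poly_Mapping.keys (chart_expo J v) = {v, (fst v, J ! fst v)}"
  using assms by (cases v) (auto simp: in_keys_iff lookup_chart_expo affine_coords_def split: if_splits)

lemma chart_expo_tmon:
  assumes "v \<in> coords Y" "J \<in> charts Y"
  shows "chart_expo J v \<in> tmon Y 0 {J}"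
proof -
  obtain a b where v: "v = (a, b)" "a < length Y" "b \<le> Y ! a" using assms(1) by (auto simp: coords_def)
  have J: "J ! a \<le> Y ! a" using assms(2) v by (simp add: charts_def)
  have "Poly_Mapping.keys (chart_expo J v) \<subseteq> coords Y"
    using keys_chart_expo[of J v] v J by (auto simp: coords_def)
  moreover have "w \<in> units_on Y {J}" if "Poly_Mapping.lookup (chart_expo J v) w < 0" for w
    using that v by (auto simp: lookup_chart_expo units_on_def split: if_splits)
  moreover have "(\<Sum>j\<le>Y ! i. Poly_Mapping.lookup (chart_expo J v) (i, j)) = 0" for i
    using v J by (cases "i = a") (auto simp: lookup_chart_expo sum_subtractf)
  ultimately show ?thesis unfolding tmon_def by blast
qed

lemma ev_chart_coord:
  assumes "v \<in> affine_coords Y J"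
  shows "ev x (chart_coord J v) = x v / x (fst v, J ! fst v)"
proof -
  have n: "v \<noteq> (fst v, J ! fst v)" using assms by (cases v) (auto simp: affine_coords_def)
  then have "mon x (chart_expo J v) = x v powi 1 * x (fst v, J ! fst v) powi (-1)"
    unfolding mon_def keys_chart_expo_affine[OF assms] by (simp add: lookup_chart_expo)
  then show ?thesis by (simp add: chart_coord_def ev_linear power_int_minus divide_inverse)
qed

text \<open>The Jacobian of the affine coordinates by their numerators is diagonal, with invertible
  entries at points of the chart. Derivatives along \<open>affine_coords\<close> therefore read off
  the linear Taylor coefficients one at a time.\<close>

lemma der_chart_coord:
  assumes "v \<in> affine_coords Y J" "w \<in> affine_coords Y J"
  shows "der x w (chart_coord J v) = (if v = w then 1 / x (fst v, J ! fst v) else 0)"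
proof -
  have n: "v \<noteq> (fst v, J ! fst v)" "w \<noteq> (fst v, J ! fst v)"
    using assms by (auto simp: affine_coords_def) (metis fst_conv snd_conv)+
  have "dmon x w (chart_expo J v) = (if v = w then x (fst v, J ! fst v) powi (-1) else 0)"
  proof (cases "v = w")
    case True
    have "Poly_Mapping.keys (chart_expo J v) - {w} = {(fst v, J ! fst v)}"
      unfolding keys_chart_expo_affine[OF assms(1)] using True n by auto
    then show ?thesis using True n by (simp add: dmon_def mon_but_def lookup_chart_expo)
  next
    case False
    then show ?thesis using n by (simp add: dmon_def lookup_chart_expo)
  qed
  then show ?thesis by (simp add: chart_coord_def der_linear power_int_minus divide_inverse)
qed

lemma der_const [simp]: "der x w (Poly_Mapping.single 0 c) = 0"
  by (simp add: der_linear dmon_def)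

lemma ev_const [simp]: "ev x (Poly_Mapping.single 0 c) = c"
  by (simp add: ev_linear mon_def)

lemma reg_const [simp]: "Poly_Mapping.single 0 c \<in> regular_at x"
  by (simp add: regular_at_def regular_expo_def)

lemma der_scale: "f \<in> regular_at x \<Longrightarrow> der x w (Poly_Mapping.single 0 c * f) = c * der x w f"
  by (simp add: der_mult)

lemma ev_scale: "f \<in> regular_at x \<Longrightarrow> ev x (Poly_Mapping.single 0 c * f) = c * ev x f"
  by (simp add: ev_mult)

locale chart_point =
  fixes Y :: mspace and p :: "'a::field mpoint" and J :: "nat list" and xs :: "'a vec list"
  assumes p: "p \<in> mpoints Y" and J: "J \<in> charts Y" and xs: "list_all2 (\<in>) xs p"
    and lies: "lies_in Y p {J}"
begin

definition affine_value :: "nat \<times> nat \<Rightarrow> 'a" where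
  "affine_value v = coord_at xs v / coord_at xs (fst v, J ! fst v)"

text \<open>The affine coordinate recentred at \<open>p\<close>; these functions form a system of
  local parameters at \<open>p\<close>.\<close>

definition local_param :: "nat \<times> nat \<Rightarrow> 'a laurent" where
  "local_param v = chart_coord J v - Poly_Mapping.single 0 (affine_value v)"

lemma unit_nonzero: "i < length Y \<Longrightarrow> coord_at xs (i, J ! i) \<noteq> 0"
  using lies_in_rep[OF p xs, of "{J}"] J lies by simp

lemma chart_coord_twist: "v \<in> affine_coords Y J \<Longrightarrow> chart_coord J v \<in> twist Y 0 {J}"
  unfolding chart_coord_def by (intro twist_single chart_expo_tmon J) (simp add: affine_coords_def)

lemma loc_point_ideal:
  assumes v: "v \<in> affine_coords Y J"
  shows "local_param v \<in> point_ideal Y p {J}"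
proof -
  have i: "fst v < length Y" and j: "snd v \<le> Y ! fst v"
    using v by (auto simp: affine_coords_def coords_def)
  \<comment> \<open>The ideal asks for vanishing at every representative; a quotient of two
    coordinates of the same factor does not change under scaling.\<close>
  have "ev (coord_at ys) (local_param v) = 0" if ys: "list_all2 (\<in>) ys p" for ys
  proof -
    obtain c where c: "c \<noteq> 0" "ys ! fst v = c \<cdot>\<^sub>v (xs ! fst v)" by (rule rep_scale[OF p xs ys i])
    have "snd v < dim_vec (xs ! fst v)" "J ! fst v < dim_vec (xs ! fst v)"
      using rep_vec(2)[OF p xs i] j J i by (auto simp: charts_def less_Suc_eq_le)
    then have "coord_at ys v / coord_at ys (fst v, J ! fst v) = affine_value v"
      using c by (simp add: affine_value_def)
    then show ?thesis by (simp add: local_param_def ev_linear(2) ev_chart_coord[OF v])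
  qed
  moreover have "local_param v \<in> twist Y 0 {J}"
    unfolding local_param_def by (intro twist_diff chart_coord_twist v twist_const)
  ultimately show ?thesis by (simp add: point_ideal_def laurent_eval_ev)
qed

abbreviation jet1 :: "'a \<Rightarrow> (nat \<times> nat \<Rightarrow> 'a) \<Rightarrow> 'a laurent" where
  "jet1 a b \<equiv> Poly_Mapping.single 0 a + (\<Sum>v\<in>affine_coords Y J. Poly_Mapping.single 0 (b v) * local_param v)"

text \<open>An expansion up to the square of the ideal of \<open>p\<close>. The coefficients stay
  existential, which makes closure properties easy; they are recovered afterwards by evaluating and
  differentiating.\<close>

definition taylor :: "'a laurent \<Rightarrow> bool" where
  "taylor f \<longleftrightarrow> (\<exists>a b. \<exists>h\<in>sq_ideal Y p {J}. f = jet1 a b + h)"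

lemma taylorI: "h \<in> sq_ideal Y p {J} \<Longrightarrow> f = jet1 a b + h \<Longrightarrow> taylor f"
  unfolding taylor_def by (intro exI bexI)

lemma taylor_const: "taylor (Poly_Mapping.single 0 c)"
  unfolding taylor_def
  by (intro exI[of _ c] exI[of _ "\<lambda>_. 0"] bexI[of _ 0]) simp_all

lemma taylor_sq: "f \<in> sq_ideal Y p {J} \<Longrightarrow> taylor f"
  unfolding taylor_def
  by (intro exI[of _ 0] exI[of _ "\<lambda>_. 0"] bexI[of _ f]) simp_all

lemma taylor_loc:
  assumes "v \<in> affine_coords Y J"
  shows "taylor (Poly_Mapping.single 0 c * local_param v)"
proof -
  have "(\<Sum>w\<in>affine_coords Y J. Poly_Mapping.single 0 (if w = v then c else 0) * local_param w) =
    (\<Sum>w\<in>affine_coords Y J. if w = v then Poly_Mapping.single 0 c * local_param v else 0)"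
    by (intro sum.cong) auto
  also have "\<dots> = Poly_Mapping.single 0 c * local_param v" using assms by simp
  finally show ?thesis unfolding taylor_def
    by (intro exI[of _ 0] exI[of _ "\<lambda>w. if w = v then c else 0"] bexI[of _ 0]) simp_all
qed

lemma taylor_add:
  assumes "taylor f" "taylor g"
  shows "taylor (f + g)"
proof -
  obtain a b h where f: "h \<in> sq_ideal Y p {J}" "f = jet1 a b + h"
    using assms(1) unfolding taylor_def by blast
  obtain a' b' h' where g: "h' \<in> sq_ideal Y p {J}" "g = jet1 a' b' + h'"
    using assms(2) unfolding taylor_def by blast
  have "f + g = jet1 (a + a') (\<lambda>v. b v + b' v) + (h + h')"
    unfolding f g by (simp add: single_add sum.distrib distrib_right)
  then show ?thesis by (rule taylorI[OF set_product_add[OF f(1) g(1)]])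
qed

lemma taylor_sum: "(\<And>i. i \<in> A \<Longrightarrow> taylor (f i)) \<Longrightarrow> taylor (sum f A)"
proof (induction A rule: infinite_finite_induct)
  case (insert x A)
  then show ?case by (simp add: taylor_add)
qed (use taylor_const[of 0] in auto)

lemma taylor_scale:
  assumes "taylor f"
  shows "taylor (Poly_Mapping.single 0 c * f)"
proof -
  obtain a b h where f: "h \<in> sq_ideal Y p {J}" "f = jet1 a b + h"
    using assms unfolding taylor_def by blast
  have "Poly_Mapping.single 0 c * f = jet1 (c * a) (\<lambda>v. c * b v) + Poly_Mapping.single 0 c * h"
    unfolding f(2)
    by (simp add: distrib_left sum_distrib_left mult_single mult.assoc[symmetric])
  then show ?thesis by (rule taylorI[OF sq_ideal_mult[OF p f(1) twist_const]])
qed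

text \<open>Multiplication by a local parameter turns the constant term into a linear one and moves
  the linear terms into the square of the ideal.\<close>

lemma taylor_loc_mult:
  assumes "taylor f" "v \<in> affine_coords Y J"
  shows "taylor (local_param v * f)"
proof -
  obtain a b h where f: "h \<in> sq_ideal Y p {J}" "f = jet1 a b + h"
    using assms(1) unfolding taylor_def by blast
  note v = loc_point_ideal[OF assms(2)]
  have eq: "local_param v * f = Poly_Mapping.single 0 a * local_param v +
     ((\<Sum>w\<in>affine_coords Y J. (Poly_Mapping.single 0 (b w) * local_param v) * local_param w) + local_param v * h)"
    unfolding f(2) by (simp add: distrib_left sum_distrib_left mult_ac)
  have "(\<Sum>w\<in>affine_coords Y J. (Poly_Mapping.single 0 (b w) * local_param v) * local_param w) \<in> sq_ideal Y p {J}"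
    by (intro set_product_sum set_product_mult point_ideal_mult[OF p v] twist_const loc_point_ideal)
  then show ?thesis unfolding eq
    by (intro taylor_add taylor_loc assms(2) taylor_sq set_product_add
        sq_ideal_mult[OF p f(1) point_ideal_twist[OF v]])
qed

lemma taylor_chart_coord_mult:
  assumes "taylor f" "v \<in> affine_coords Y J"
  shows "taylor (chart_coord J v * f)"
proof -
  have "chart_coord J v * f = local_param v * f + Poly_Mapping.single 0 (affine_value v) * f"
    by (simp add: local_param_def algebra_simps)
  then show ?thesis using taylor_add[OF taylor_loc_mult[OF assms] taylor_scale[OF assms(1)]] by simp
qed

text \<open>A monomial of degree zero that is regular on the chart is a product of affine
  coordinates. The induction on the total affine degree splits off one of them at a time.\<close>

lemma taylor_monomial:
  "m \<in> tmon Y 0 {J} \<Longrightarrow> taylor (Poly_Mapping.single m 1)"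
proof (induction "\<Sum>v\<in>affine_coords Y J. nat (Poly_Mapping.lookup m v)" arbitrary: m rule: less_induct)
  case less
  have nonneg: "Poly_Mapping.lookup m v \<ge> 0" if "v \<in> affine_coords Y J" for v
  proof (rule ccontr)
    assume "\<not> ?thesis"
    then have "v \<in> units_on Y {J}" using tmonD(2)[OF less.prems] by simp
    then show False using that by (auto simp: units_on_def affine_coords_def)
  qed
  show ?case
  proof (cases "\<exists>v\<in>affine_coords Y J. Poly_Mapping.lookup m v > 0")
    case True
    then obtain v where v: "v \<in> affine_coords Y J" "Poly_Mapping.lookup m v > 0" by blast
    \<comment> \<open>\<open>k\<close> is the exponent of the quotient by the affine coordinate
      \<open>v\<close>; its affine exponents stay nonnegative because that of \<open>v\<close> was
      positive.\<close>
    define k where "k = m - chart_expo J v"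
    have km: "m = chart_expo J v + k" by (simp add: k_def)
    have lk: "Poly_Mapping.lookup k w = Poly_Mapping.lookup m w - (if w = v then 1 else 0)"
      if "w \<in> affine_coords Y J" for w
    proof -
      have "w \<noteq> (fst v, J ! fst v)" using that by (auto simp: affine_coords_def)
      then show ?thesis by (simp add: k_def lookup_minus lookup_chart_expo)
    qed
    have "v \<in> coords Y" using v by (simp add: affine_coords_def)
    note c = chart_expo_tmon[OF this J]
    have "k \<in> tmon Y 0 {J}"
    proof -
      have kc: "Poly_Mapping.keys k \<subseteq> coords Y"
        using tmonD(1)[OF c] tmonD(1)[OF less.prems] keys_diff[of m "chart_expo J v"]
        unfolding k_def by blast
      moreover have "w \<in> units_on Y {J}" if "Poly_Mapping.lookup k w < 0" for w
      proof -
        have "w \<in> Poly_Mapping.keys k" using that by (simp add: in_keys_iff)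
        with kc have "w \<in> coords Y" by blast
        moreover have "w \<notin> affine_coords Y J"
          using that lk[of w] nonneg[of w] v(2) by (auto split: if_splits)
        ultimately show ?thesis by (cases w) (auto simp: affine_coords_def units_on_def coords_def)
      qed
      moreover have "(\<Sum>j\<le>Y ! i. Poly_Mapping.lookup k (i, j)) = 0" if "i < length Y" for i
        using tmonD(3)[OF c that] tmonD(3)[OF less.prems that]
        by (simp add: k_def lookup_minus sum_subtractf)
      ultimately show ?thesis unfolding tmon_def by blast
    qed
    moreover have "(\<Sum>w\<in>affine_coords Y J. nat (Poly_Mapping.lookup k w)) <
        (\<Sum>w\<in>affine_coords Y J. nat (Poly_Mapping.lookup m w))"
      using v by (intro sum_strict_mono_ex1) (auto simp: lk)
    ultimately have "taylor (Poly_Mapping.single k 1)" by (rule less.hyps[rotated])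
    from taylor_chart_coord_mult[OF this v(1)] show ?thesis
      by (simp add: chart_coord_def mult_single km[symmetric])
  next
    case False
    have z: "Poly_Mapping.lookup m v = 0" if v: "v \<in> affine_coords Y J" for v
    proof -
      have "\<not> Poly_Mapping.lookup m v > 0" using False v by blast
      then show ?thesis using nonneg[OF v] by linarith
    qed
    \<comment> \<open>Once all affine exponents in factor \<open>i\<close> vanish, degree zero in
      that factor forces the exponent of the denominator \<open>J ! i\<close> to vanish too.\<close>
    have l0: "Poly_Mapping.lookup m (i, j) = 0" for i j
    proof (cases "(i, j) \<in> coords Y")
      case True
      then have i: "i < length Y" "J ! i \<le> Y ! i" using J by (auto simp: coords_def charts_def)
      have "(\<Sum>j\<le>Y ! i. Poly_Mapping.lookup m (i, j)) = (\<Sum>j\<in>{J ! i}. Poly_Mapping.lookup m (i, j))"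
        using i by (intro sum.mono_neutral_right) (auto intro!: z simp: affine_coords_def coords_def)
      then have u: "Poly_Mapping.lookup m (i, J ! i) = 0"
        using tmonD(3)[OF less.prems i(1)] by simp
      show ?thesis
      proof (cases "j = J ! i")
        case j: True
        show ?thesis unfolding j by (rule u)
      next
        case False
        then show ?thesis using True by (intro z) (simp add: affine_coords_def)
      qed
    next
      case False
      then have "(i, j) \<notin> Poly_Mapping.keys m" using tmonD(1)[OF less.prems] by blast
      then show ?thesis by (simp add: in_keys_iff)
    qed
    have "m = 0"
    proof (rule poly_mapping_eqI)
      fix v show "Poly_Mapping.lookup m v = Poly_Mapping.lookup 0 v" using l0 by (cases v) simp
    qed
    then show ?thesis using taylor_const[of 1] by simp
  qed
qed

lemma taylor_twist:
  assumes "f \<in> twist Y 0 {J}"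
  shows "taylor f"
proof -
  have "taylor (\<Sum>m\<in>Poly_Mapping.keys f. Poly_Mapping.single m (Poly_Mapping.lookup f m))"
  proof (rule taylor_sum)
    fix m assume "m \<in> Poly_Mapping.keys f"
    then have "taylor (Poly_Mapping.single m 1)" using assms by (auto simp: twist_iff intro: taylor_monomial)
    from taylor_scale[OF this, of "Poly_Mapping.lookup f m"]
    show "taylor (Poly_Mapping.single m (Poly_Mapping.lookup f m))" by (simp add: mult_single)
  qed
  then show ?thesis using poly_mapping_monomials[of f] by simp
qed

text \<open>The hard half of the jet criterion on a chart. Value and derivatives of the expansion
  return \<open>a\<close> and, up to a nonzero factor, each \<open>b v\<close>; when they all
  vanish, only the part in the squared ideal is left.\<close>

lemma sq_ideal_if_jet_0:
  assumes f: "f \<in> twist Y 0 {J}" and e: "ev (coord_at xs) f = 0"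
    and d: "\<And>v. v \<in> affine_coords Y J \<Longrightarrow> der (coord_at xs) v f = 0"
  shows "f \<in> sq_ideal Y p {J}"
proof -
  obtain a b h where h: "h \<in> sq_ideal Y p {J}" and fh: "f = jet1 a b + h"
    using taylor_twist[OF f] unfolding taylor_def by blast
  note jh = sq_ideal_jet[OF p xs lies h]
  have l: "local_param v \<in> regular_at (coord_at xs)" "ev (coord_at xs) (local_param v) = 0" if "v \<in> affine_coords Y J" for v
    using loc_point_ideal[OF that] reg_twist[OF p xs lies, of _ 0] lies xs
    by (auto simp: point_ideal_def laurent_eval_ev)
  have "ev (coord_at xs) f = a"
    unfolding fh using jh l by (simp add: ev_linear(1,4) ev_scale)
  with e have a: "a = 0" by simp
  have b: "b v = 0" if v: "v \<in> affine_coords Y J" for v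
  proof -
    have u: "coord_at xs (fst v, J ! fst v) \<noteq> 0"
      using unit_nonzero[of "fst v"] v by (auto simp: affine_coords_def coords_def)
    have "der (coord_at xs) v f = (\<Sum>w\<in>affine_coords Y J. b w * der (coord_at xs) v (local_param w))"
      unfolding fh using jh l by (simp add: der_linear(1,4) der_scale)
    also have "\<dots> = (\<Sum>w\<in>affine_coords Y J. if w = v then b v / coord_at xs (fst v, J ! fst v) else 0)"
      by (intro sum.cong refl) (simp add: local_param_def der_linear(2) der_chart_coord[OF _ v])
    also have "\<dots> = b v / coord_at xs (fst v, J ! fst v)" using v by simp
    finally show ?thesis using d[OF v] u by simp
  qed
  have "f = h" unfolding fh by (simp add: a b)
  with h show ?thesis by simp
qed

end

section \<open>Cech cochains\<close>

text \<open>The exponent of the multilinear monomial \<open>\<Prod>i. x_{(i, \<phi> i)}\<close>, one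
  coordinate for each factor. By \<open>tmon_global_multi\<close> all monomials of global forms of
  multidegree \<open>(1, \<dots>, 1)\<close> are of this kind.\<close>

definition multi :: "mspace \<Rightarrow> (nat \<Rightarrow> nat) \<Rightarrow> exponent" where
  "multi Y \<phi> = (\<Sum>i<length Y. Poly_Mapping.single (i, \<phi> i) 1)"

lemma lookup_multi:
  "Poly_Mapping.lookup (multi Y \<phi>) (i, j) = (if i < length Y \<and> j = \<phi> i then 1 else 0)"
proof -
  have "Poly_Mapping.lookup (multi Y \<phi>) (i, j) =
      (\<Sum>k<length Y. if k = i then (if j = \<phi> i then 1 else 0) else 0)"
    unfolding multi_def lookup_sum
    by (intro sum.cong) (auto simp: lookup_single when_def)
  then show ?thesis by simp
qed

lemma keys_multi: "Poly_Mapping.keys (multi Y \<phi>) = {(i, \<phi> i) | i. i < length Y}"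
proof (rule Set.set_eqI)
  fix v show "v \<in> Poly_Mapping.keys (multi Y \<phi>) \<longleftrightarrow> v \<in> {(i, \<phi> i) | i. i < length Y}"
    by (cases v) (auto simp: in_keys_iff lookup_multi)
qed

lemma multi_tmon:
  assumes "\<And>i. i < length Y \<Longrightarrow> \<phi> i \<le> Y ! i"
  shows "multi Y \<phi> \<in> tmon Y 1 W"
proof -
  have "Poly_Mapping.keys (multi Y \<phi>) \<subseteq> coords Y"
    unfolding keys_multi coords_def using assms by blast
  moreover have "\<not> Poly_Mapping.lookup (multi Y \<phi>) v < 0" for v
    by (cases v) (simp add: lookup_multi)
  ultimately show ?thesis using assms by (simp add: tmon_def lookup_multi)
qed

lemma minus_multi_tmon:
  assumes J: "J \<in> charts Y"
  shows "- multi Y ((!) J) \<in> tmon Y (-1) {J}"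
proof -
  have m: "multi Y ((!) J) \<in> tmon Y 1 {J}" using J by (intro multi_tmon) (simp add: charts_def)
  have "v \<in> units_on Y {J}" if "Poly_Mapping.lookup (- multi Y ((!) J)) v < 0" for v
    using that by (cases v) (auto simp: lookup_multi units_on_def split: if_splits)
  then show ?thesis
    using tmonD(1)[OF m] tmonD(3)[OF m] unfolding tmon_def by (simp add: sum_negf keys_uminus)
qed

text \<open>On the chart the line bundle is trivialised by \<open>\<Prod>i. x_{(i, J ! i)}\<close>.
  Dividing by this unit preserves a zero jet, and the quotient \<open>g\<close> falls under the
  criterion for functions.\<close>

lemma double_sheaf_if_jets_0:
  assumes S: "S \<subseteq> mpoints Y" and J: "J \<in> charts Y" and f: "f \<in> twist Y 1 {J}"
    and jet: "\<And>p. p \<in> S \<Longrightarrow> lies_in Y p {J} \<Longrightarrow> \<exists>xs. list_all2 (\<in>) xs p \<and>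
      ev (coord_at xs) f = 0 \<and> (\<forall>v\<in>coords Y. der (coord_at xs) v f = 0)"
  shows "f \<in> double_sheaf Y S {J}"
proof -
  define u where "u = multi Y ((!) J)"
  define g where "g = Poly_Mapping.single (- u) 1 * f"
  have u: "Poly_Mapping.single u 1 \<in> twist Y 1 {J}"
    unfolding u_def by (intro twist_single multi_tmon) (use J in \<open>simp add: charts_def\<close>)
  have u': "Poly_Mapping.single (- u) 1 \<in> twist Y (-1) {J}"
    unfolding u_def by (intro twist_single minus_multi_tmon J)
  have g: "g \<in> twist Y 0 {J}" using twist_mult[OF u' f] by (simp add: g_def)
  have fg: "f = g * Poly_Mapping.single u 1"
  proof -
    have "g * Poly_Mapping.single u 1 = (Poly_Mapping.single (- u) 1 * Poly_Mapping.single u 1) * f"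
      by (simp only: g_def mult_ac)
    then show ?thesis by (simp add: mult_single)
  qed
  have "g \<in> sq_ideal Y p {J}" if p: "p \<in> S" for p
  proof (cases "lies_in Y p {J}")
    case True
    obtain xs where rep: "list_all2 (\<in>) xs p" and
      e0: "ev (coord_at xs) f = 0" and d0: "\<forall>v\<in>coords Y. der (coord_at xs) v f = 0"
      using jet[OF p True] by blast
    have pY: "p \<in> mpoints Y" using S p by blast
    interpret chart_point Y p J xs by (rule chart_point.intro[OF pY J rep True])
    note r = reg_twist[OF pY rep True u'] reg_twist[OF pY rep True f]
    have "ev (coord_at xs) g = 0" using r e0 by (simp add: g_def ev_mult)
    moreover have "der (coord_at xs) v g = 0" if "v \<in> affine_coords Y J" for v
    proof -
      have "der (coord_at xs) v f = 0" using d0 that by (simp add: affine_coords_def)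
      then show ?thesis using r e0 by (simp add: g_def der_mult)
    qed
    ultimately show ?thesis by (rule sq_ideal_if_jet_0[OF g])
  next
    case False
    then have PI: "point_ideal Y p {J} = twist Y 0 {J}" by (simp add: point_ideal_def)
    \<comment> \<open>At a point outside the chart the ideal is the whole coordinate ring, which
      contains both \<open>g\<close> and \<open>1\<close>.\<close>
    have "g * 1 \<in> sq_ideal Y p {J}" unfolding PI by (rule set_product_mult[OF g twist_1])
    then show ?thesis by simp
  qed
  then have "g \<in> double_ideal Y S {J}" using g by (simp add: double_ideal_def)
  then show ?thesis unfolding double_sheaf_def fg by (rule set_product_mult[OF _ u])
qed

lemma finite_charts: "finite (charts Y)"
proof (rule finite_subset)
  show "charts Y \<subseteq> {J. set J \<subseteq> {..sum_list Y} \<and> length J = length Y}"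
  proof
    fix J assume J: "J \<in> charts Y"
    have "j \<le> sum_list Y" if "j \<in> set J" for j
    proof -
      obtain i where i: "i < length J" "j = J ! i" using \<open>j \<in> set J\<close> by (auto simp: in_set_conv_nth)
      then have "j \<le> Y ! i" "Y ! i \<in> set Y" using J by (auto simp: charts_def)
      then show ?thesis using member_le_sum_list[of "Y ! i" Y] by simp
    qed
    then show "J \<in> {J. set J \<subseteq> {..sum_list Y} \<and> length J = length Y}" using J by (auto simp: charts_def)
  qed
qed (simp add: finite_lists_length_eq)

text \<open>This is the vanishing of \<open>H^1(Y, O(1, \<dots>, 1))\<close> on the level of
  cocycles. It is proved one monomial at a time, by a cone construction whose vertex is a chart that
  contributes no denominator to that monomial.\<close>

lemma cech_H1_twist_1:
  fixes s :: "nat list \<Rightarrow> nat list \<Rightarrow> 'a::field laurent"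
  assumes s: "\<And>a b. a \<in> charts Y \<Longrightarrow> b \<in> charts Y \<Longrightarrow> s a b \<in> twist Y 1 {a, b}"
    and cocycle: "\<And>a b c. a \<in> charts Y \<Longrightarrow> b \<in> charts Y \<Longrightarrow> c \<in> charts Y \<Longrightarrow> s a b = s a c + s c b"
  obtains \<sigma> where "\<And>a. a \<in> charts Y \<Longrightarrow> \<sigma> a \<in> twist Y 1 {a}"
    "\<And>a b. a \<in> charts Y \<Longrightarrow> b \<in> charts Y \<Longrightarrow> s a b = \<sigma> b - \<sigma> a"
proof -
  define K where "K = (\<Union>a\<in>charts Y. \<Union>b\<in>charts Y. Poly_Mapping.keys (s a b))"
  have finK: "finite K" unfolding K_def by (simp add: finite_charts)
  have "\<exists>J\<in>charts Y. \<forall>i<length Y. Poly_Mapping.lookup m (i, J ! i) \<ge> 0" if m: "m \<in> K" for m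
  proof -
    obtain a b where ab: "a \<in> charts Y" "b \<in> charts Y" "m \<in> Poly_Mapping.keys (s a b)"
      using m by (auto simp: K_def)
    have t: "m \<in> tmon Y 1 {a, b}" using s[OF ab(1,2)] ab(3) by (auto simp: twist_iff)
    \<comment> \<open>Exponents that are all negative cannot add up to the degree \<open>1\<close>,
      so each factor has a coordinate with nonnegative exponent.\<close>
    have ex: "\<exists>j. j \<le> Y ! i \<and> Poly_Mapping.lookup m (i, j) \<ge> 0" if "i < length Y" for i
    proof (rule ccontr)
      assume "\<not> ?thesis"
      then have "(\<Sum>j\<le>Y ! i. Poly_Mapping.lookup m (i, j)) \<le> 0" by (intro sum_nonpos) force
      with tmonD(3)[OF t that] show False by simp
    qed
    let ?J = "map (\<lambda>i. SOME j. j \<le> Y ! i \<and> Poly_Mapping.lookup m (i, j) \<ge> 0) [0..<length Y]"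
    have "?J ! i \<le> Y ! i \<and> Poly_Mapping.lookup m (i, ?J ! i) \<ge> 0" if "i < length Y" for i
      using someI_ex[OF ex[OF that]] that by simp
    then show ?thesis by (intro bexI[of _ ?J]) (auto simp: charts_def)
  qed
  then obtain js where js: "\<And>m. m \<in> K \<Longrightarrow> js m \<in> charts Y"
    "\<And>m i. m \<in> K \<Longrightarrow> i < length Y \<Longrightarrow> Poly_Mapping.lookup m (i, js m ! i) \<ge> 0"
    by metis
  \<comment> \<open>The contracting homotopy: the coefficient of \<open>m\<close> is taken from the
    cocycle on the pair formed by the vertex \<open>js m\<close> and \<open>J\<close>.\<close>
  define \<sigma> where "\<sigma> J = (\<Sum>m\<in>K. Poly_Mapping.single m (Poly_Mapping.lookup (s (js m) J) m))" for J
  have lookup_\<sigma>: "Poly_Mapping.lookup (\<sigma> J) m = (if m \<in> K then Poly_Mapping.lookup (s (js m) J) m else 0)" for J m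
    using finK unfolding \<sigma>_def lookup_sum lookup_single when_def by simp
  have "\<sigma> a \<in> twist Y 1 {a}" if a: "a \<in> charts Y" for a
    unfolding twist_iff
  proof
    fix m assume "m \<in> Poly_Mapping.keys (\<sigma> a)"
    then have m: "m \<in> K" "m \<in> Poly_Mapping.keys (s (js m) a)"
      by (auto simp: in_keys_iff lookup_\<sigma> split: if_splits)
    have t: "m \<in> tmon Y 1 {js m, a}" using s[OF js(1)[OF m(1)] a] m(2) by (auto simp: twist_iff)
    have "v \<in> units_on Y {a}" if v: "Poly_Mapping.lookup m v < 0" for v
    proof -
      obtain i where i: "i < length Y" "v = (i, js m ! i) \<or> v = (i, a ! i)"
        using tmonD(2)[OF t v] by (auto simp: units_on_def)
      \<comment> \<open>The coordinates of the vertex have nonnegative exponent in \<open>m\<close>,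
        so every denominator of \<open>m\<close> comes from \<open>a\<close>.\<close>
      have "v \<noteq> (i, js m ! i)" using js(2)[OF m(1) i(1)] v by auto
      then show ?thesis using i by (auto simp: units_on_def)
    qed
    then show "m \<in> tmon Y 1 {a}" using t unfolding tmon_def by blast
  qed
  moreover have "s a b = \<sigma> b - \<sigma> a" if ab: "a \<in> charts Y" "b \<in> charts Y" for a b
  proof (rule poly_mapping_eqI)
    fix m
    show "Poly_Mapping.lookup (s a b) m = Poly_Mapping.lookup (\<sigma> b - \<sigma> a) m"
    proof (cases "m \<in> K")
      case True
      then have "s (js m) b = s (js m) a + s a b" using js(1) ab by (intro cocycle) auto
      then show ?thesis using True by (simp add: lookup_minus lookup_\<sigma> lookup_add)
    next
      case False
      then have "m \<notin> Poly_Mapping.keys (s a b)" using ab by (auto simp: K_def)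
      then show ?thesis using False by (simp add: lookup_minus lookup_\<sigma> in_keys_iff)
    qed
  qed
  ultimately show ?thesis by (rule that)
qed

section \<open>Positivity of quotient dimensions\<close>

lemma quotient_dim_pos_ex:
  fixes Z B :: "('j \<Rightarrow> 'a::field laurent) set"
  assumes "quotient_dim Z B > 0"
  shows "\<exists>s\<in>Z. s \<notin> B"
proof -
  let ?P = "\<lambda>A. finite A \<and> A \<subseteq> Z \<and>
     (\<forall>c. (\<lambda>js. \<Sum>s\<in>A. Poly_Mapping.single 0 (c s) * s js) \<in> B \<longrightarrow> (\<forall>s\<in>A. c s = 0))"
  have "\<exists>e\<in>{enat (card A) | A. ?P A}. 0 < e"
    using assms unfolding quotient_dim_def less_Sup_iff .
  then obtain A where PA: "?P A" and "0 < enat (card A)" by blast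
  then have A: "finite A" "A \<subseteq> Z" "card A > 0" by (simp_all add: zero_enat_def)
  from PA have indep: "\<And>c. (\<lambda>js. \<Sum>s\<in>A. Poly_Mapping.single 0 (c s) * s js) \<in> B \<Longrightarrow> \<forall>s\<in>A. c s = 0"
    by blast
  have "A \<noteq> {}" using A(3) by (metis card.empty less_irrefl)
  then obtain s where s: "s \<in> A" by blast
  \<comment> \<open>Indicator coefficients single out \<open>s\<close>: if \<open>s\<close> were in
    \<open>B\<close>, independence would give \<open>1 = 0\<close>.\<close>
  have eq: "(\<lambda>js. \<Sum>t\<in>A. Poly_Mapping.single 0 (if t = s then 1 else 0) * t js) = s"
  proof
    fix js
    have "(\<Sum>t\<in>A. Poly_Mapping.single 0 (if t = s then 1 else 0) * t js) = (\<Sum>t\<in>A. if t = s then s js else 0)"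
      by (intro sum.cong) auto
    then show "(\<Sum>t\<in>A. Poly_Mapping.single 0 (if t = s then 1 else 0) * t js) = s js"
      using s A(1) by simp
  qed
  have "s \<notin> B"
  proof
    assume "s \<in> B"
    then have "\<forall>t\<in>A. (if t = s then 1 else 0) = (0::'a)"
      by (intro indep) (simp only: eq)
    from bspec[OF this s] show False by simp
  qed
  then show ?thesis using s A(2) by blast
qed

lemma quotient_dim_posI:
  fixes Z B :: "('j \<Rightarrow> 'a::field laurent) set"
  assumes "s \<in> Z" "\<And>c. (\<lambda>js. Poly_Mapping.single 0 c * s js) \<in> B \<Longrightarrow> c = 0"
  shows "quotient_dim Z B > 0"
proof -
  have "enat (card {s}) \<le> quotient_dim Z B"
    unfolding quotient_dim_def
  proof (rule Sup_upper, intro CollectI exI[of _ "{s}"] conjI allI impI)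
    fix c :: "('j \<Rightarrow> 'a laurent) \<Rightarrow> 'a"
    assume "(\<lambda>js. \<Sum>t\<in>{s}. Poly_Mapping.single 0 (c t) * t js) \<in> B"
    then show "\<forall>t\<in>{s}. c t = 0" using assms(2)[of "c s"] by simp
  qed (use assms(1) in auto)
  moreover have "enat (card {s}) > 0" by (simp add: zero_enat_def)
  ultimately show ?thesis by (rule less_le_trans[rotated])
qed

section \<open>Cocycles and coboundaries in low degree\<close>

lemma tuples_0: "js \<in> tuples I 0 \<longleftrightarrow> (\<exists>a\<in>I. js = [a])"
  by (auto simp: tuples_def length_Suc_conv)

lemma tuples_1: "js \<in> tuples I (Suc 0) \<longleftrightarrow> (\<exists>a\<in>I. \<exists>b\<in>I. js = [a, b])"
  by (auto simp: tuples_def length_Suc_conv)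

lemma tuples_2: "js \<in> tuples I (Suc (Suc 0)) \<longleftrightarrow> (\<exists>a\<in>I. \<exists>b\<in>I. \<exists>c\<in>I. js = [a, b, c])"
  by (auto simp: tuples_def length_Suc_conv)

lemma differential_0:
  "a \<in> I \<Longrightarrow> b \<in> I \<Longrightarrow> differential I 0 s [a, b] = s [b] - s [a]"
  by (simp add: differential_def tuples_1 lessThan_Suc numeral_2_eq_2)

lemma differential_1:
  "a \<in> I \<Longrightarrow> b \<in> I \<Longrightarrow> c \<in> I \<Longrightarrow> differential I (Suc 0) s [a, b, c] = s [b, c] - s [a, c] + s [a, b]"
  by (simp add: differential_def tuples_2 lessThan_Suc numeral_3_eq_3)

lemma cochainsD:
  assumes "s \<in> cochains I F q"
  shows "js \<in> tuples I q \<Longrightarrow> s js \<in> F (set js)" "js \<notin> tuples I q \<Longrightarrow> s js = 0"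
proof -
  from assms have "if js \<in> tuples I q then s js \<in> F (set js) else s js = 0"
    unfolding cochains_def mem_Collect_eq by (rule spec)
  then show "js \<in> tuples I q \<Longrightarrow> s js \<in> F (set js)" "js \<notin> tuples I q \<Longrightarrow> s js = 0"
    by simp_all
qed

lemma cocycles_0D:
  assumes "s \<in> cocycles I F 0"
  shows "a \<in> I \<Longrightarrow> s [a] \<in> F {a}" "a \<in> I \<Longrightarrow> b \<in> I \<Longrightarrow> s [a] = s [b]"
    "js \<notin> tuples I 0 \<Longrightarrow> s js = 0"
proof -
  have c: "s \<in> cochains I F 0" "differential I 0 s = (\<lambda>_. 0)"
    using assms by (auto simp: cocycles_def)
  show "s [a] \<in> F {a}" if "a \<in> I"
  proof -
    have "[a] \<in> tuples I 0" using that by (simp add: tuples_0)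
    from cochainsD(1)[OF c(1) this] show ?thesis by simp
  qed
  show "s [a] = s [b]" if "a \<in> I" "b \<in> I"
    using differential_0[OF that, of s] by (simp add: c(2))
  show "s js = 0" if "js \<notin> tuples I 0"
    by (rule cochainsD(2)[OF c(1) that])
qed

lemma cocycles_0I:
  assumes "\<And>a. a \<in> I \<Longrightarrow> f \<in> F {a}"
  shows "(\<lambda>js. if js \<in> tuples I 0 then f else 0) \<in> cocycles I F 0" (is "?s \<in> _")
proof -
  have "?s \<in> cochains I F 0" using assms by (auto simp: cochains_def tuples_0)
  moreover have "differential I 0 ?s js = 0" for js
  proof (cases "js \<in> tuples I (Suc 0)")
    case True
    then obtain a b where ab: "a \<in> I" "b \<in> I" "js = [a, b]" by (auto simp: tuples_1)
    then show ?thesis using differential_0[OF ab(1,2), of ?s] by (simp add: tuples_0)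
  qed (simp add: differential_def)
  ultimately show ?thesis by (simp add: cocycles_def fun_eq_iff)
qed

lemma cocycles_1D:
  assumes "s \<in> cocycles I F (Suc 0)"
  shows "a \<in> I \<Longrightarrow> b \<in> I \<Longrightarrow> s [a, b] \<in> F {a, b}"
    "a \<in> I \<Longrightarrow> b \<in> I \<Longrightarrow> c \<in> I \<Longrightarrow> s [a, b] = s [a, c] + s [c, b]"
    "js \<notin> tuples I (Suc 0) \<Longrightarrow> s js = 0"
proof -
  have c: "s \<in> cochains I F (Suc 0)" "differential I (Suc 0) s = (\<lambda>_. 0)"
    using assms by (auto simp: cocycles_def)
  show "s [a, b] \<in> F {a, b}" if "a \<in> I" "b \<in> I"
  proof -
    have "[a, b] \<in> tuples I (Suc 0)" using that by (simp add: tuples_1)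
    from cochainsD(1)[OF c(1) this] show ?thesis by simp
  qed
  show "s [a, b] = s [a, c] + s [c, b]" if "a \<in> I" "b \<in> I" "c \<in> I"
    using differential_1[of a I c b s] that by (simp add: c(2) algebra_simps)
  show "s js = 0" if "js \<notin> tuples I (Suc 0)"
    by (rule cochainsD(2)[OF c(1) that])
qed

lemma coboundaryI:
  assumes s: "s \<in> cocycles I F (Suc 0)" and \<tau>: "\<And>a. a \<in> I \<Longrightarrow> \<tau> a \<in> F {a}"
    and eq: "\<And>a b. a \<in> I \<Longrightarrow> b \<in> I \<Longrightarrow> s [a, b] = \<tau> b - \<tau> a"
  shows "s \<in> coboundaries I F (Suc 0)"
proof -
  define t where "t js = (if js \<in> tuples I 0 then \<tau> (hd js) else 0)" for js
  have t1: "t [a] = \<tau> a" if "a \<in> I" for a using that by (simp add: t_def tuples_0)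
  have "t js \<in> F (set js)" if "js \<in> tuples I 0" for js
    using that \<tau> by (auto simp: tuples_0 t1)
  then have "t \<in> cochains I F 0" by (simp add: cochains_def t_def)
  moreover have "s = differential I 0 t"
  proof
    fix js
    show "s js = differential I 0 t js"
    proof (cases "js \<in> tuples I (Suc 0)")
      case True
      then obtain a b where ab: "a \<in> I" "b \<in> I" "js = [a, b]" by (auto simp: tuples_1)
      then show ?thesis using differential_0[OF ab(1,2), of t] by (simp add: eq t1)
    next
      case False
      then show ?thesis using cocycles_1D(3)[OF s] by (simp add: differential_def)
    qed
  qed
  ultimately show ?thesis by simp
qed

section \<open>Global sections and surfaces\<close>

lemma point_in_chart:
  assumes "p \<in> mpoints Y"
  shows "\<exists>J\<in>charts Y. lies_in Y p {J}"
proof -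
  obtain xs where xs: "list_all2 (\<in>) xs p" using rep_exists[OF assms] by blast
  have ex: "\<exists>j. j \<le> Y ! i \<and> xs ! i $ j \<noteq> 0" if i: "i < length Y" for i
  proof (rule ccontr)
    assume "\<not> ?thesis"
    then have "xs ! i = 0\<^sub>v (Suc (Y ! i))"
      using rep_vec(2)[OF assms xs i] by (intro eq_vecI) (auto simp: less_Suc_eq_le)
    then show False using rep_vec(3)[OF assms xs i] by simp
  qed
  let ?J = "map (\<lambda>i. SOME j. j \<le> Y ! i \<and> xs ! i $ j \<noteq> 0) [0..<length Y]"
  have J: "?J ! i \<le> Y ! i \<and> xs ! i $ (?J ! i) \<noteq> 0" if "i < length Y" for i
    using someI_ex[OF ex[OF that]] that by simp
  then have c: "?J \<in> charts Y" by (simp add: charts_def)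
  moreover have "lies_in Y p {?J}"
    using lies_in_rep[OF assms xs, of "{?J}"] c J by simp
  ultimately show ?thesis by blast
qed

text \<open>A coordinate with negative exponent would have to be a unit on every chart. Positive
  dimension of the factors provides a chart that avoids it.\<close>

lemma twist_global:
  assumes Y: "multiprojective Y" and f: "\<And>J. J \<in> charts Y \<Longrightarrow> f \<in> twist Y d {J}"
  shows "f \<in> twist Y d {}"
  unfolding twist_iff
proof
  fix m assume m: "m \<in> Poly_Mapping.keys f"
  have t: "m \<in> tmon Y d {J}" if "J \<in> charts Y" for J
    using f[OF that] m by (auto simp: twist_iff)
  have "replicate (length Y) 0 \<in> charts Y" by (simp add: charts_def)
  note t0 = t[OF this]
  have "\<not> Poly_Mapping.lookup m v < 0" for v
  proof
    assume v: "Poly_Mapping.lookup m v < 0"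
    \<comment> \<open>In every factor this chart selects a coordinate with index different from
      \<open>snd v\<close>.\<close>
    define J :: "nat list" where "J = map (\<lambda>i. if snd v = 0 then 1 else 0) [0..<length Y]"
    have "Y ! i > 0" if "i < length Y" for i using Y that by (auto simp: multiprojective_def)
    then have "J \<in> charts Y" by (auto simp: J_def charts_def Suc_le_eq)
    from tmonD(2)[OF t[OF this] v] show False by (auto simp: J_def units_on_def split: if_splits)
  qed
  then show "m \<in> tmon Y d {}" using t0 unfolding tmon_def by blast
qed

lemma tmon_global_nonneg: "m \<in> tmon Y d {} \<Longrightarrow> Poly_Mapping.lookup m v \<ge> 0"
  using tmonD(2)[of m Y d "{}" v] by (fastforce simp: units_on_def)

text \<open>Nonnegative integers with sum \<open>1\<close> in each factor: exactly one of them is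
  \<open>1\<close>, and its position defines \<open>\<phi>\<close>.\<close>

lemma tmon_global_multi:
  assumes m: "m \<in> tmon Y 1 {}"
  shows "\<exists>\<phi>. (\<forall>i<length Y. \<phi> i \<le> Y ! i) \<and> m = multi Y \<phi>"
proof -
  have ex: "\<exists>j. j \<le> Y ! i \<and> (\<forall>k. Poly_Mapping.lookup m (i, k) = (if k = j then 1 else 0))"
    if i: "i < length Y" for i
  proof -
    note s = tmonD(3)[OF m i]
    have "\<exists>j\<in>{..Y ! i}. Poly_Mapping.lookup m (i, j) \<noteq> 0"
    proof (rule ccontr)
      assume "\<not> ?thesis"
      then have "(\<Sum>j\<le>Y ! i. Poly_Mapping.lookup m (i, j)) = 0" by (intro sum.neutral) blast
      with s show False by simp
    qed
    then obtain j where j: "j \<le> Y ! i" "Poly_Mapping.lookup m (i, j) \<noteq> 0" by blast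
    have pos: "Poly_Mapping.lookup m (i, j) \<ge> 1"
      using j(2) tmon_global_nonneg[OF m, of "(i, j)"] by linarith
    have split: "Poly_Mapping.lookup m (i, j) + (\<Sum>k\<in>{..Y ! i} - {j}. Poly_Mapping.lookup m (i, k)) = 1"
      using s j(1) by (simp add: sum.remove[of "{..Y ! i}" j])
    have "(\<Sum>k\<in>{..Y ! i} - {j}. Poly_Mapping.lookup m (i, k)) \<ge> 0"
      by (intro sum_nonneg tmon_global_nonneg[OF m])
    with split pos have one: "Poly_Mapping.lookup m (i, j) = 1"
      and zero: "(\<Sum>k\<in>{..Y ! i} - {j}. Poly_Mapping.lookup m (i, k)) = 0" by linarith+
    have "Poly_Mapping.lookup m (i, k) = 0" if "k \<noteq> j" for k
    proof (cases "k \<le> Y ! i")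
      case True
      have "\<forall>k\<in>{..Y ! i} - {j}. Poly_Mapping.lookup m (i, k) = 0"
        using zero tmon_global_nonneg[OF m] by (subst (asm) sum_nonneg_eq_0_iff) auto
      then show ?thesis using True that by simp
    next
      case False
      then have "(i, k) \<notin> Poly_Mapping.keys m" using tmonD(1)[OF m] by (auto simp: coords_def)
      then show ?thesis by (simp add: in_keys_iff)
    qed
    then show ?thesis using j(1) one by (intro exI[of _ j]) simp
  qed
  define \<phi> where "\<phi> i = (SOME j. j \<le> Y ! i \<and> (\<forall>k. Poly_Mapping.lookup m (i, k) = (if k = j then 1 else 0)))" for i
  have \<phi>: "\<phi> i \<le> Y ! i \<and> (\<forall>k. Poly_Mapping.lookup m (i, k) = (if k = \<phi> i then 1 else 0))" if "i < length Y" for i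
    unfolding \<phi>_def by (rule someI_ex[OF ex[OF that]])
  have "m = multi Y \<phi>"
  proof (rule poly_mapping_eqI)
    fix v :: "nat \<times> nat"
    obtain i k where v: "v = (i, k)" by (cases v)
    show "Poly_Mapping.lookup m v = Poly_Mapping.lookup (multi Y \<phi>) v"
    proof (cases "i < length Y")
      case True
      then show ?thesis using \<phi>[OF True] by (simp add: v lookup_multi)
    next
      case False
      then have "(i, k) \<notin> Poly_Mapping.keys m" using tmonD(1)[OF m] by (auto simp: coords_def)
      then show ?thesis using False by (simp add: v lookup_multi in_keys_iff)
    qed
  qed
  with \<phi> show ?thesis by blast
qed

lemma multi_cong: "(\<And>i. i < length Y \<Longrightarrow> \<phi> i = \<psi> i) \<Longrightarrow> multi Y \<phi> = multi Y \<psi>"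
  unfolding multi_def by (intro sum.cong) auto

lemma dmon_multi:
  assumes "a < length Y"
  shows "dmon x (a, b) (multi Y \<phi>) = (if b = \<phi> a then \<Prod>i\<in>{..<length Y} - {a}. x (i, \<phi> i) else 0)"
proof (cases "b = \<phi> a")
  case True
  have "Poly_Mapping.keys (multi Y \<phi>) - {(a, b)} = (\<lambda>i. (i, \<phi> i)) ` ({..<length Y} - {a})"
    unfolding keys_multi True by auto
  then have "mon_but x (a, b) (multi Y \<phi>) = (\<Prod>i\<in>{..<length Y} - {a}. x (i, \<phi> i))"
    unfolding mon_but_def by (simp add: prod.reindex inj_on_def lookup_multi)
  then show ?thesis using True assms by (simp add: dmon_def lookup_multi)
next
  case False
  then show ?thesis by (simp add: dmon_def lookup_multi)
qed

text \<open>With one factor the form is linear, and its partial derivatives at any \<open>x\<close>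
  are its coefficients; a hyperplane has no singular point.\<close>

lemma global_section_1_factor:
  assumes f: "f \<in> twist Y 1 {}" and Y: "length Y = 1"
    and d: "\<And>v. v \<in> coords Y \<Longrightarrow> der x v f = 0"
  shows "f = 0"
proof (rule poly_mapping_eqI)
  fix m
  show "Poly_Mapping.lookup f m = Poly_Mapping.lookup 0 m"
  proof (cases "m \<in> Poly_Mapping.keys f")
    case True
    then have "m \<in> tmon Y 1 {}" using f by (auto simp: twist_iff)
    then obtain \<phi> where \<phi>: "\<forall>i<length Y. \<phi> i \<le> Y ! i" and m: "m = multi Y \<phi>"
      using tmon_global_multi by blast
    have "dmon x (0, \<phi> 0) k = (if k = m then 1 else 0)" if k: "k \<in> Poly_Mapping.keys f" for k
    proof -
      have "k \<in> tmon Y 1 {}" using f k by (auto simp: twist_iff)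
      then obtain \<psi> where k: "k = multi Y \<psi>" using tmon_global_multi by blast
      have eq: "multi Y \<psi> = multi Y \<phi> \<longleftrightarrow> \<phi> 0 = \<psi> 0"
      proof
        assume "multi Y \<psi> = multi Y \<phi>"
        then have "Poly_Mapping.lookup (multi Y \<psi>) (0, \<phi> 0) = Poly_Mapping.lookup (multi Y \<phi>) (0, \<phi> 0)"
          by simp
        then show "\<phi> 0 = \<psi> 0" using Y by (simp add: lookup_multi split: if_splits)
      next
        assume "\<phi> 0 = \<psi> 0"
        then show "multi Y \<psi> = multi Y \<phi>" using Y by (intro multi_cong) simp
      qed
      have e: "{..<length Y} - {0} = {}" and l: "0 < length Y" using Y by auto
      show ?thesis unfolding k m eq dmon_multi[OF l] e by simp
    qed
    then have "der x (0, \<phi> 0) f = (\<Sum>k\<in>Poly_Mapping.keys f. if k = m then Poly_Mapping.lookup f m else 0)"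
      unfolding der_def lin_ext_def by (intro sum.cong) auto
    also have "\<dots> = Poly_Mapping.lookup f m" using True by simp
    finally show ?thesis using d[of "(0, \<phi> 0)"] \<phi> Y by (simp add: coords_def)
  next
    case False
    then show ?thesis by (simp add: in_keys_iff)
  qed
qed

lemma solve_2x2:
  fixes a b :: "'a::field"
  assumes "x * v - y * u \<noteq> 0" "x * a + y * b = 0" "u * a + v * b = 0"
  shows "a = 0 \<and> b = 0"
proof -
  have "(x * v - y * u) * a = v * (x * a + y * b) - y * (u * a + v * b)"
    "(x * v - y * u) * b = x * (u * a + v * b) - u * (x * a + y * b)" by (simp_all add: algebra_simps)
  then have "(x * v - y * u) * a = 0" "(x * v - y * u) * b = 0"
    unfolding assms(2,3) by simp_all
  then show ?thesis using assms(1) by simp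
qed

text \<open>A bilinear form with matrix \<open>c\<close> that is singular at \<open>x\<close> and
  \<open>y\<close> is annihilated by both vectors of either point. In the factor \<open>k\<close>
  where the points differ, the two vectors form a basis, so \<open>c\<close> vanishes.\<close>

lemma global_section_P1_P1:
  fixes f :: "'a::field laurent"
  assumes f: "f \<in> twist [1, 1] 1 {}"
    and x: "\<And>v. v \<in> coords [1, 1] \<Longrightarrow> der x v f = 0" and y: "\<And>v. v \<in> coords [1, 1] \<Longrightarrow> der y v f = 0"
    and indep: "k < 2" "x (k, 0) * y (k, 1) - x (k, 1) * y (k, 0) \<noteq> 0"
  shows "f = 0"
proof -
  define M where "M a b = multi [1, 1] ((!) [a, b])" for a b
  define c where "c a b = Poly_Mapping.lookup f (M a b)" for a b
  have M_eq: "M a b = M a' b' \<longleftrightarrow> a = a' \<and> b = b'" for a b a' b'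
  proof
    assume e: "M a b = M a' b'"
    have "Poly_Mapping.lookup (M a b) (0, a) = Poly_Mapping.lookup (M a' b') (0, a)"
      "Poly_Mapping.lookup (M a b) (1, b) = Poly_Mapping.lookup (M a' b') (1, b)" by (simp_all add: e)
    then show "a = a' \<and> b = b'" by (simp add: M_def lookup_multi split: if_splits)
  qed simp
  have keys: "Poly_Mapping.keys f \<subseteq> {M 0 0, M 0 1, M 1 0, M 1 1}"
  proof
    fix m assume "m \<in> Poly_Mapping.keys f"
    then have "m \<in> tmon [1, 1] 1 {}" using f by (auto simp: twist_iff)
    then obtain \<phi> where \<phi>: "\<forall>i<length [1::nat, 1]. \<phi> i \<le> [1, 1] ! i" and m: "m = multi [1, 1] \<phi>"
      using tmon_global_multi by blast
    have "m = M (\<phi> 0) (\<phi> 1)" unfolding m M_def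
      by (intro multi_cong) (auto simp: less_Suc_eq numeral_2_eq_2)
    moreover have "\<phi> 0 \<in> {0, 1}" "\<phi> 1 \<in> {0, 1}" using \<phi>[THEN spec, of 0] \<phi>[THEN spec, of 1] by auto
    ultimately show "m \<in> {M 0 0, M 0 1, M 1 0, M 1 1}" by auto
  qed
  have lin_ext: "lin_ext \<phi> f = c 0 0 * \<phi> (M 0 0) + c 0 1 * \<phi> (M 0 1) + c 1 0 * \<phi> (M 1 0) + c 1 1 * \<phi> (M 1 1)" for \<phi>
    using lin_superset[OF _ keys, of \<phi>] by (simp add: M_eq c_def)
  have s: "{..<length [1::nat, 1]} - {0} = {1}" "{..<length [1::nat, 1]} - {1} = {0}" by auto
  have d0: "dmon z (0, j) (M a b) = (if j = a then z (1, b) else 0)" for z :: "_ \<Rightarrow> 'a" and a b j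
    using dmon_multi[of 0 "[1, 1]" z j "(!) [a, b]"] unfolding s by (simp add: M_def)
  have d1: "dmon z (1, j) (M a b) = (if j = b then z (0, a) else 0)" for z :: "_ \<Rightarrow> 'a" and a b j
    using dmon_multi[of 1 "[1, 1]" z j "(!) [a, b]"] unfolding s by (simp add: M_def)
  have co: "(0, 0) \<in> coords [1, 1]" "(0, 1) \<in> coords [1, 1]" "(1, 0) \<in> coords [1, 1]" "(1, 1) \<in> coords [1, 1]"
    by (simp_all add: coords_def)
  note X = x[OF co(1)] x[OF co(2)] x[OF co(3)] x[OF co(4)]
    y[OF co(1)] y[OF co(2)] y[OF co(3)] y[OF co(4)]
  \<comment> \<open>Derivatives by the coordinates of one factor are the rows or columns of
    \<open>c\<close> paired with the vector of the other factor.\<close>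
  have eqs: "z (1, 0) * c 0 0 + z (1, 1) * c 0 1 = 0" "z (1, 0) * c 1 0 + z (1, 1) * c 1 1 = 0"
    "z (0, 0) * c 0 0 + z (0, 1) * c 1 0 = 0" "z (0, 0) * c 0 1 + z (0, 1) * c 1 1 = 0"
    if "z = x \<or> z = y" for z
    using that X by (auto simp: der_def lin_ext d0 d1[unfolded One_nat_def] mult.commute)
  have "c 0 0 = 0 \<and> c 0 1 = 0 \<and> c 1 0 = 0 \<and> c 1 1 = 0"
  proof (cases "k = 0")
    case True
    then show ?thesis
      using solve_2x2[OF indep(2), of "c 0 0" "c 1 0"] solve_2x2[OF indep(2), of "c 0 1" "c 1 1"]
        eqs[of x] eqs[of y] by simp
  next
    case False
    with indep(1) have "k = 1" by simp
    then show ?thesis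
      using solve_2x2[OF indep(2), of "c 0 0" "c 0 1"] solve_2x2[OF indep(2), of "c 1 0" "c 1 1"]
        eqs[of x] eqs[of y] by simp
  qed
  then have "Poly_Mapping.lookup f m = 0" for m
    using keys by (cases "m \<in> Poly_Mapping.keys f") (auto simp: c_def in_keys_iff)
  then show ?thesis by (intro poly_mapping_eqI) simp
qed

text \<open>If the determinant vanishes, the two nonzero vectors are proportional and hence
  represent the same point of \<open>P^1\<close>.\<close>

lemma P1_points_indep:
  assumes p: "p \<in> mpoints Y" "list_all2 (\<in>) xs p" and q: "q \<in> mpoints Y" "list_all2 (\<in>) ys q"
    and i: "i < length Y" "Y ! i = 1" "p ! i \<noteq> q ! i"
  shows "coord_at xs (i, 0) * coord_at ys (i, 1) - coord_at xs (i, 1) * coord_at ys (i, 0) \<noteq> 0"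
proof
  assume det: "coord_at xs (i, 0) * coord_at ys (i, 1) - coord_at xs (i, 1) * coord_at ys (i, 0) = 0"
  define u v where "u = xs ! i" and "v = ys ! i"
  have u: "dim_vec u = 2" "u \<noteq> 0\<^sub>v 2" and pu: "p ! i = {c \<cdot>\<^sub>v u | c. c \<noteq> 0}"
    using rep_vec[OF p i(1)] i(2) by (auto simp: u_def)
  have v: "dim_vec v = 2" "v \<noteq> 0\<^sub>v 2" and qv: "q ! i = {c \<cdot>\<^sub>v v | c. c \<noteq> 0}"
    using rep_vec[OF q i(1)] i(2) by (auto simp: v_def)
  have det': "u $ 0 * v $ 1 = u $ 1 * v $ 0" using det by (simp add: u_def v_def)
  have nz: "w $ 0 \<noteq> 0 \<or> w $ 1 \<noteq> 0" if "dim_vec w = 2" "w \<noteq> 0\<^sub>v 2" for w :: "'a vec"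
  proof (rule ccontr)
    assume "\<not> ?thesis"
    then have "w = 0\<^sub>v 2" using that by (intro eq_vecI) (auto simp: less_2_cases_iff)
    with that show False by simp
  qed
  have "\<exists>c. c \<noteq> 0 \<and> v = c \<cdot>\<^sub>v u"
  proof (cases "u $ 0 = 0")
    case True
    then have u1: "u $ 1 \<noteq> 0" using nz[OF u] by simp
    then have v0: "v $ 0 = 0" using det' True by simp
    then have "v $ 1 \<noteq> 0" using nz[OF v] by simp
    moreover have "v = (v $ 1 / u $ 1) \<cdot>\<^sub>v u"
      using u v u1 v0 True by (intro eq_vecI) (auto simp: less_2_cases_iff)
    ultimately show ?thesis using u1 by (intro exI[of _ "v $ 1 / u $ 1"]) simp
  next
    case False
    then have v1: "v $ 1 = v $ 0 / u $ 0 * u $ 1" using det' by (simp add: field_simps)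
    then have "v $ 0 \<noteq> 0" using nz[OF v] by auto
    moreover have "v = (v $ 0 / u $ 0) \<cdot>\<^sub>v u"
      using u v v1 False by (intro eq_vecI) (auto simp: less_2_cases_iff)
    ultimately show ?thesis using False by (intro exI[of _ "v $ 0 / u $ 0"]) simp
  qed
  then obtain c where c: "c \<noteq> 0" "v = c \<cdot>\<^sub>v u" by blast
  have "q ! i = p ! i"
  proof (intro Set.set_eqI iffI)
    fix w assume "w \<in> q ! i"
    then obtain d where "d \<noteq> 0" "w = (d * c) \<cdot>\<^sub>v u" unfolding qv c(2) by (auto simp: smult_smult_assoc)
    then show "w \<in> p ! i" unfolding pu using c(1) by (intro CollectI exI[of _ "d * c"]) simp
  next
    fix w assume "w \<in> p ! i"
    then obtain d where d: "d \<noteq> 0" "w = d \<cdot>\<^sub>v u" unfolding pu by auto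
    then have "w = (d / c) \<cdot>\<^sub>v v" using c by (simp add: smult_smult_assoc)
    then show "w \<in> q ! i" unfolding qv using c d by (intro CollectI exI[of _ "d / c"]) simp
  qed
  with i(3) show False by simp
qed

lemma mpoints_diff:
  assumes "p \<in> mpoints Y" "q \<in> mpoints Y" "p \<noteq> q"
  obtains i where "i < length Y" "p ! i \<noteq> q ! i"
proof -
  have "length p = length Y" "length q = length Y" using assms by (auto simp: mpoints_def)
  then show ?thesis using assms(3) that nth_equalityI[of p q] by fastforce
qed

lemma global_section_jet_0:
  fixes S :: "'a::field mpoint set"
  assumes Y: "multiprojective Y" and S: "S \<subseteq> mpoints Y"
    and s: "s \<in> cocycles (charts Y) (double_sheaf Y S) 0" and J0: "J0 \<in> charts Y"
  shows "s [J0] \<in> twist Y 1 {}"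
    "p \<in> S \<Longrightarrow> list_all2 (\<in>) xs p \<Longrightarrow> der (coord_at xs) v (s [J0]) = 0"
proof -
  have e: "s [J] = s [J0]" if "J \<in> charts Y" for J using cocycles_0D(2)[OF s that J0] .
  have F: "s [J0] \<in> double_sheaf Y S {J}" if "J \<in> charts Y" for J
    using cocycles_0D(1)[OF s that] e[OF that] by simp
  show "s [J0] \<in> twist Y 1 {}"
    by (intro twist_global Y double_sheaf_twist[OF F])
  assume p: "p \<in> S" and xs: "list_all2 (\<in>) xs p"
  then have pY: "p \<in> mpoints Y" using S by blast
  obtain J where J: "J \<in> charts Y" "lies_in Y p {J}" using point_in_chart[OF pY] by blast
  show "der (coord_at xs) v (s [J0]) = 0"
    using double_sheaf_jet[OF pY xs J(2) p F[OF J(1)]] by blast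
qed

lemma h0_dim_2:
  fixes S :: "'a::field mpoint set"
  assumes Y: "multiprojective Y" and dim: "sum_list Y = 2" and S: "S \<subseteq> mpoints Y"
    and pq: "p \<in> S" "q \<in> S" "p \<noteq> q"
  shows "\<not> cohomology_dim Y (double_sheaf Y S) 0 > 0"
proof
  assume "cohomology_dim Y (double_sheaf Y S) 0 > 0"
  then have "quotient_dim (cocycles (charts Y) (double_sheaf Y S) 0) {\<lambda>_. 0} > 0"
    unfolding cohomology_dim_def coboundaries.simps .
  from quotient_dim_pos_ex[OF this]
  obtain s where s: "s \<in> cocycles (charts Y) (double_sheaf Y S) 0" "s \<noteq> (\<lambda>_. 0)" by blast
  have pqY: "p \<in> mpoints Y" "q \<in> mpoints Y" using pq S by auto
  obtain xs ys where xs: "list_all2 (\<in>) xs p" and ys: "list_all2 (\<in>) ys q"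
    using rep_exists[OF pqY(1)] rep_exists[OF pqY(2)] by blast
  have "s [J] = 0" if J: "J \<in> charts Y" for J
  proof -
    note g = global_section_jet_0[OF Y S s(1) J]
    note dx = g(2)[OF pq(1) xs] and dy = g(2)[OF pq(2) ys]
    \<comment> \<open>Positive dimensions with sum \<open>2\<close> leave one factor or two
      projective lines.\<close>
    consider "length Y = 1" | "Y = [1, 1]"
    proof -
      have pos: "\<And>n. n \<in> set Y \<Longrightarrow> n > 0" and ne: "Y \<noteq> []" using Y by (auto simp: multiprojective_def)
      obtain a Z where a: "Y = a # Z" using ne by (cases Y) auto
      show thesis
      proof (cases Z)
        case Nil
        then show ?thesis using a that(1) by simp
      next
        case (Cons b Z')
        have "a > 0" "b > 0" using pos a Cons by auto
        moreover have "Z' = []"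
        proof (cases Z')
          case Cons': (Cons c Z'')
          then have "c > 0" using pos a Cons by auto
          then show ?thesis using dim a Cons Cons' \<open>a > 0\<close> \<open>b > 0\<close> by simp
        qed
        ultimately show ?thesis using a Cons dim that(2) by simp
      qed
    qed
    then show "s [J] = 0"
    proof cases
      case 1
      show ?thesis by (rule global_section_1_factor[OF g(1) 1, where x = "coord_at xs"]) (rule dx)
    next
      case 2
      obtain i where i: "i < length Y" "p ! i \<noteq> q ! i" by (rule mpoints_diff[OF pqY pq(3)])
      have i2: "i < 2" using i 2 by simp
      have "Y ! i = 1" using i2 2 by (auto simp: less_2_cases_iff)
      note indep = P1_points_indep[OF pqY(1) xs pqY(2) ys i(1) this i(2)]
      have g1: "s [J] \<in> twist [1, 1] 1 {}" using g(1) 2 by simp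
      show ?thesis
        by (rule global_section_P1_P1[where x = "coord_at xs" and y = "coord_at ys", OF g1 dx dy i2 indep])
    qed
  qed
  then have "s js = 0" for js
    using cocycles_0D(3)[OF s(1)] by (cases "js \<in> tuples (charts Y) 0") (auto simp: tuples_0)
  with s(2) show False by auto
qed

section \<open>Two points\<close>

lemma proj_class_subset_span:
  fixes v :: "'a::field vec"
  assumes W: "W \<subseteq> carrier_vec n" and v: "v \<in> W"
  shows "{c \<cdot>\<^sub>v v | c. c \<noteq> 0} \<subseteq> LinearCombinations.module.span class_ring (module_vec TYPE('a) n) W"
proof -
  interpret vec_space "TYPE('a)" n .
  from span_mem[OF W v] have "c \<cdot>\<^sub>v v \<in> span W" for c by (rule smult_in_span[OF W])
  then show ?thesis by (intro subsetI) (elim CollectE exE conjE, simp only:)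
qed

text \<open>One vector from each of the two classes already generates the space of dimension
  \<open>m + 1\<close>, so \<open>m + 1\<close> is at most the number of distinct vectors
  chosen.\<close>

lemma two_points_span:
  fixes P Q :: "'a::field ppoint"
  assumes m: "m > 0" and P: "P \<in> proj_space m" and Q: "Q \<in> proj_space m"
    and span: "proj_span m {P, Q} = proj_space m"
  shows "m = 1 \<and> P \<noteq> Q"
proof -
  obtain v where v: "P = {c \<cdot>\<^sub>v v | c. c \<noteq> 0}" "v \<in> carrier_vec (Suc m)"
    using P unfolding proj_space_def by blast
  \<comment> \<open>If the points coincide, the same representative is taken, so that
    \<open>{v, w}\<close> has only one element.\<close>
  obtain w where w: "Q = {c \<cdot>\<^sub>v w | c. c \<noteq> 0}" "w \<in> carrier_vec (Suc m)" "P = Q \<Longrightarrow> w = v"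
  proof (cases "P = Q")
    case True
    then show ?thesis using v by (intro that[of v]) auto
  next
    case False
    then show ?thesis using Q that unfolding proj_space_def by blast
  qed
  interpret vec_space "TYPE('a)" "Suc m" .
  have vw: "{v, w} \<subseteq> carrier_vec (Suc m)" using v w by simp
  have "\<Union>{P, Q} \<subseteq> span {v, w}"
    using proj_class_subset_span[OF vw, of v] proj_class_subset_span[OF vw, of w] v(1) w(1) by simp
  then have sub: "span (\<Union>{P, Q}) \<subseteq> span {v, w}"
    by (rule span_is_subset) (rule span_is_submodule, simp add: v(2) w(2))
  have "u \<in> span {v, w}" if u: "u \<in> carrier_vec (Suc m)" for u :: "'a vec"
  proof (cases "u = 0\<^sub>v (Suc m)")
    case True
    have "v \<in> span {v, w}" by (rule span_mem) (simp_all add: v(2) w(2))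
    then have "0 \<cdot>\<^sub>v v \<in> span {v, w}" by (rule smult_in_span[OF vw])
    moreover have "0 \<cdot>\<^sub>v v = u" using True v(2) by simp
    ultimately show ?thesis by simp
  next
    case False
    let ?U = "{c \<cdot>\<^sub>v u | c. c \<noteq> 0}"
    have "?U \<in> proj_space m" unfolding proj_space_def
      by (rule CollectI, rule exI[of _ u], intro conjI refl u False)
    then have "?U \<in> proj_span m {P, Q}" unfolding span .
    then have U: "?U \<subseteq> span (\<Union>{P, Q})" unfolding proj_span_def by (elim CollectE conjE)
    have "1 \<cdot>\<^sub>v u \<in> ?U" by (intro CollectI exI[of _ 1]) simp
    from subsetD[OF sub subsetD[OF U this]] have "1 \<cdot>\<^sub>v u \<in> span {v, w}" .
    then show ?thesis unfolding one_smult_vec .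
  qed
  then have "carrier_vec (Suc m) \<subseteq> span {v, w}" by (rule subsetI)
  moreover have "span {v, w} \<subseteq> carrier_vec (Suc m)" by (rule span_is_subset2[unfolded cV, OF vw])
  ultimately have gen: "span {v, w} = carrier_vec (Suc m)" by (rule equalityI[rotated])
  have "Suc m \<le> card {v, w}"
    using gen_ge_dim[OF _ vw gen] unfolding dim_is_n by blast
  moreover have "card {v, w} \<le> 2" by (simp add: card_insert_if)
  moreover have "card {v, w} = 1" if "P = Q" using w(3)[OF that] by simp
  ultimately show ?thesis using m by auto
qed

section \<open>Products of linear forms in different factors\<close>

definition multideg :: "mspace \<Rightarrow> nat set \<Rightarrow> 'a::field laurent set" where
  "multideg Y A = {f. \<forall>m\<in>Poly_Mapping.keys f. Poly_Mapping.keys m \<subseteq> coords Y \<and>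
     (\<forall>v. Poly_Mapping.lookup m v \<ge> 0) \<and>
     (\<forall>i<length Y. (\<Sum>j\<le>Y ! i. Poly_Mapping.lookup m (i, j)) = (if i \<in> A then 1 else 0))}"

text \<open>A \<open>twist\<close> has the same degree in all factors, which partial products of
  linear forms lack. Tracking the set of factors already used covers the intermediate
  products.\<close>

lemma multideg_mult:
  assumes f: "f \<in> multideg Y A" and g: "g \<in> multideg Y B" and AB: "A \<inter> B = {}"
  shows "f * g \<in> multideg Y (A \<union> B)"
  unfolding multideg_def
proof (intro CollectI ballI)
  fix m assume "m \<in> Poly_Mapping.keys (f * g)"
  then obtain a b where m: "m = a + b" and a: "a \<in> Poly_Mapping.keys f" and b: "b \<in> Poly_Mapping.keys g"
    using keys_mult[of f g] by blast
  have A: "Poly_Mapping.keys a \<subseteq> coords Y" "\<And>v. Poly_Mapping.lookup a v \<ge> 0"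
    "\<And>i. i < length Y \<Longrightarrow> (\<Sum>j\<le>Y ! i. Poly_Mapping.lookup a (i, j)) = (if i \<in> A then 1 else 0)"
    using f a unfolding multideg_def by blast+
  have B: "Poly_Mapping.keys b \<subseteq> coords Y" "\<And>v. Poly_Mapping.lookup b v \<ge> 0"
    "\<And>i. i < length Y \<Longrightarrow> (\<Sum>j\<le>Y ! i. Poly_Mapping.lookup b (i, j)) = (if i \<in> B then 1 else 0)"
    using g b unfolding multideg_def by blast+
  have "Poly_Mapping.keys m \<subseteq> coords Y" using A(1) B(1) keys_add[of a b] unfolding m by blast
  moreover have "Poly_Mapping.lookup m v \<ge> 0" for v using A(2) B(2) by (simp add: m lookup_add)
  moreover have "(\<Sum>j\<le>Y ! i. Poly_Mapping.lookup m (i, j)) = (if i \<in> A \<union> B then 1 else 0)"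
    if "i < length Y" for i
    using A(3)[OF that] B(3)[OF that] AB by (auto simp: m lookup_add sum.distrib)
  ultimately show "Poly_Mapping.keys m \<subseteq> coords Y \<and> (\<forall>v. Poly_Mapping.lookup m v \<ge> 0) \<and>
     (\<forall>i<length Y. (\<Sum>j\<le>Y ! i. Poly_Mapping.lookup m (i, j)) = (if i \<in> A \<union> B then 1 else 0))"
    by blast
qed

lemma multideg_add:
  "f \<in> multideg Y A \<Longrightarrow> g \<in> multideg Y A \<Longrightarrow> f + g \<in> multideg Y A"
  unfolding multideg_def using keys_add[of f g] by blast

lemma multideg_0 [simp]: "0 \<in> multideg Y A"
  by (simp add: multideg_def)

lemma multideg_sum: "(\<And>i. i \<in> I \<Longrightarrow> f i \<in> multideg Y A) \<Longrightarrow> sum f I \<in> multideg Y A"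
  by (induction I rule: infinite_finite_induct) (simp_all add: multideg_add)

lemma multideg_const: "Poly_Mapping.single 0 c \<in> multideg Y {}"
  by (simp add: multideg_def)

lemma multideg_1: "1 \<in> multideg Y {}"
  using multideg_const[of 1] by simp

lemma multideg_prod:
  assumes "finite A" "\<And>k. k \<in> A \<Longrightarrow> f k \<in> multideg Y {k}"
  shows "prod f A \<in> multideg Y A"
  using assms
proof (induction A rule: finite_induct)
  case (insert k A)
  then have "f k * prod f A \<in> multideg Y ({k} \<union> A)" by (intro multideg_mult) auto
  then show ?case using insert by simp
qed (simp add: multideg_1)

lemma multideg_reg: "f \<in> multideg Y A \<Longrightarrow> f \<in> regular_at x"
  unfolding multideg_def regular_at_def regular_expo_def by (auto simp: not_less[symmetric])

lemma multideg_twist: "f \<in> multideg Y {..<length Y} \<Longrightarrow> f \<in> twist Y 1 {}"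
  unfolding multideg_def twist_iff tmon_def by (auto simp: not_less[symmetric])

definition linear_form :: "nat \<Rightarrow> (nat \<Rightarrow> 'a::field) \<Rightarrow> 'a laurent" where
  "linear_form k c = (\<Sum>j\<le>1. Poly_Mapping.single (Poly_Mapping.single (k, j) 1) (c j))"

lemma lf_multideg:
  assumes "k < length Y" "Y ! k = 1"
  shows "linear_form k c \<in> multideg Y {k}"
proof -
  have "Poly_Mapping.single (Poly_Mapping.single (k, j) 1) (c j) \<in> multideg Y {k}" if "j \<le> 1" for j
    unfolding multideg_def
  proof (intro CollectI ballI)
    fix m assume "m \<in> Poly_Mapping.keys (Poly_Mapping.single (Poly_Mapping.single (k, j) 1 :: exponent) (c j))"
    then have m: "m = Poly_Mapping.single (k, j) 1" by (simp split: if_splits)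
    have "Poly_Mapping.keys m \<subseteq> coords Y" using assms that by (simp add: m coords_def)
    moreover have "Poly_Mapping.lookup m v \<ge> 0" for v by (simp add: m lookup_single when_def)
    moreover have "(\<Sum>l\<le>Y ! i. Poly_Mapping.lookup m (i, l)) = (if i \<in> {k} then 1 else 0)" for i
    proof (cases "i = k")
      case True
      then have "(\<Sum>l\<le>Y ! i. Poly_Mapping.lookup m (i, l)) = (\<Sum>l\<le>1. if j = l then 1 else 0)"
        using assms by (simp add: m lookup_single when_def)
      then show ?thesis using True that by simp
    next
      case False
      then show ?thesis by (simp add: m lookup_single)
    qed
    ultimately show "Poly_Mapping.keys m \<subseteq> coords Y \<and> (\<forall>v. Poly_Mapping.lookup m v \<ge> 0) \<and>
     (\<forall>i<length Y. (\<Sum>j\<le>Y ! i. Poly_Mapping.lookup m (i, j)) = (if i \<in> {k} then 1 else 0))" by blast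
  qed
  then show ?thesis unfolding linear_form_def by (intro multideg_sum) simp
qed

lemma ev_lf: "ev x (linear_form k c) = c 0 * x (k, 0) + c 1 * x (k, 1)"
  by (simp add: linear_form_def ev_linear mon_def)

lemma der_lf: "der x (a, b) (linear_form k c) = (if a = k \<and> b \<le> 1 then c b else 0)"
proof -
  have "dmon x (a, b) (Poly_Mapping.single (k, j) 1) = (if a = k \<and> b = j then 1 else 0)" for j
    by (simp add: dmon_def mon_but_def lookup_single when_def)
  then have "der x (a, b) (linear_form k c) = (\<Sum>j\<le>1. if j = b then (if a = k then c b else 0) else 0)"
    unfolding linear_form_def der_linear by (intro sum.cong) auto
  then show ?thesis by simp
qed

lemma ev_prod:
  assumes "finite A" "\<And>k. k \<in> A \<Longrightarrow> f k \<in> multideg Y {k}"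
  shows "ev x (prod f A) = (\<Prod>k\<in>A. ev x (f k))"
  using assms
proof (induction A rule: finite_induct)
  case empty
  have "ev x (Poly_Mapping.single 0 1) = 1" by (rule ev_const)
  then show ?case by simp
next
  case (insert k A)
  have "f k \<in> regular_at x" "prod f A \<in> regular_at x"
    using insert multideg_reg multideg_prod[of A f Y] by blast+
  then show ?case using insert by (simp add: ev_mult)
qed

lemma der_1 [simp]: "der x v 1 = 0"
  using der_const[of x v 1] by simp

lemma der_prod_0:
  assumes "finite A" "\<And>k. k \<in> A \<Longrightarrow> f k \<in> multideg Y {k}" "\<And>k. k \<in> A \<Longrightarrow> der x v (f k) = 0"
  shows "der x v (prod f A) = 0"
  using assms
proof (induction A rule: finite_induct)
  case (insert k A)
  have "f k \<in> regular_at x" "prod f A \<in> regular_at x"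
    using insert multideg_reg multideg_prod[of A f Y] by blast+
  then show ?case using insert by (simp add: der_mult)
qed simp

text \<open>One differentiation removes the zero of at most one factor, so the other factor still
  annihilates each term of the Leibniz rule.\<close>

lemma der_prod_two_zeros:
  assumes A: "finite A" "\<And>k. k \<in> A \<Longrightarrow> f k \<in> multideg Y {k}"
    and a: "a \<in> A" "ev x (f a) = 0" and b: "b \<in> A" "ev x (f b) = 0" and ab: "a \<noteq> b"
  shows "der x v (prod f A) = 0"
proof -
  have "prod f A = f a * (f b * prod f (A - {a} - {b}))"
    using A a b ab by (simp add: prod.remove[of A a] prod.remove[of "A - {a}" b])
  moreover have "f a \<in> regular_at x" "f b \<in> regular_at x" "prod f (A - {a} - {b}) \<in> regular_at x"
    using A a b multideg_reg multideg_prod[of "A - {a} - {b}" f Y] by blast+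
  ultimately show ?thesis using a b by (simp add: der_mult ev_mult reg_mult)
qed

text \<open>Here \<open>c\<close> is the prescribed gradient and \<open>e\<close> the prescribed
  value at \<open>x\<close>; the relations \<open>euler\<close> are those satisfied by the jet of
  any form of degree one in each factor.\<close>

lemma separating_section:
  fixes x y :: "nat \<times> nat \<Rightarrow> 'a::field"
  assumes Y: "\<And>i. i < length Y \<Longrightarrow> Y ! i = 1" and n: "length Y \<ge> 3"
    and indep: "\<And>i. i < length Y \<Longrightarrow> x (i, 0) * y (i, 1) - x (i, 1) * y (i, 0) \<noteq> 0"
    and euler: "\<And>i. i < length Y \<Longrightarrow> c (i, 0) * x (i, 0) + c (i, 1) * x (i, 1) = e"
  shows "\<exists>g\<in>twist Y 1 {}. ev x g = e \<and> (\<forall>v\<in>coords Y. der x v g = c v) \<and>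
    ev y g = 0 \<and> (\<forall>v\<in>coords Y. der y v g = 0)"
proof -
  let ?N = "{..<length Y}"
  \<comment> \<open>Coefficients of the linear form \<open>L i\<close> on factor \<open>i\<close>
    normalised to be \<open>1\<close> at \<open>x\<close> and \<open>0\<close> at
    \<open>y\<close>.\<close>
  define l where "l i j = (if j = 0 then y (i, 1) else - y (i, 0)) / (x (i, 0) * y (i, 1) - x (i, 1) * y (i, 0))"
    for i and j :: nat
  define L where "L i = linear_form i (l i)" for i
  define P where "P i = prod L (?N - {i})" for i
  \<comment> \<open>After subtracting \<open>e * l i\<close>, the linear form with coefficients
    \<open>d i\<close> vanishes at \<open>x\<close> by the Euler relation. Hence in \<open>g\<close>
    the last summand carries the value \<open>e\<close>, and the \<open>i\<close>-th summand affects
    only the derivatives along factor \<open>i\<close>.\<close>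
  define d where "d i j = c (i, j) - e * l i j" for i j
  define g where "g = (\<Sum>i\<in>?N. linear_form i (d i) * P i) + Poly_Mapping.single 0 e * prod L ?N"
  have L: "L i \<in> multideg Y {i}" if "i < length Y" for i
    unfolding L_def by (rule lf_multideg[OF that Y[OF that]])
  have L': "L i \<in> multideg Y {i}" if "i \<in> ?N" for i using L that by simp
  have Lx: "ev x (L i) = 1" if "i < length Y" for i
    using indep[OF that] unfolding L_def ev_lf l_def
    by (simp add: diff_divide_distrib[symmetric] mult.commute[of "y _"])
  have Ly: "ev y (L i) = 0" for i
    by (simp add: L_def ev_lf l_def)
  have P: "P i \<in> multideg Y (?N - {i})" for i
    unfolding P_def by (rule multideg_prod) (use L in auto)
  have Px: "ev x (P i) = 1" for i
    unfolding P_def by (subst ev_prod[where Y = Y]) (use L Lx in auto)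
  \<comment> \<open>With at least three factors, each \<open>P i\<close> contains two forms
    vanishing at \<open>y\<close>; this gives the zero jet there.\<close>
  have two: "\<exists>a b. a \<in> ?N - {i} \<and> b \<in> ?N - {i} \<and> a \<noteq> b" for i
    by (rule exI[of _ "if i = 0 then 1 else 0"], rule exI[of _ "if i = 2 then 1 else 2"]) (use n in auto)
  have Py: "ev y (P i) = 0" for i
  proof -
    obtain a where "a \<in> ?N - {i}" using two by blast
    then have "(\<Prod>k\<in>?N - {i}. ev y (L k)) = 0" using Ly by (intro prod_zero) auto
    moreover have "ev y (P i) = (\<Prod>k\<in>?N - {i}. ev y (L k))"
      unfolding P_def by (rule ev_prod[where Y = Y]) (use L in auto)
    ultimately show ?thesis by simp
  qed
  have dPy: "der y v (P i) = 0" for i v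
  proof -
    obtain a b where ab: "a \<in> ?N - {i}" "b \<in> ?N - {i}" "a \<noteq> b" using two by blast
    show ?thesis unfolding P_def
      by (rule der_prod_two_zeros[where Y = Y, OF _ _ ab(1) Ly ab(2) Ly ab(3)]) (use L in auto)
  qed
  have dPx: "der x (i, b) (P i) = 0" for i b
    unfolding P_def by (rule der_prod_0[where Y = Y]) (use L in \<open>auto simp: L_def der_lf\<close>)
  have LP: "prod L ?N = L i * P i" if "i < length Y" for i
    unfolding P_def using that by (simp add: prod.remove[of ?N i])
  have dx: "ev x (linear_form i (d i)) = 0" if i: "i < length Y" for i
  proof -
    have "ev x (linear_form i (d i)) = (c (i, 0) * x (i, 0) + c (i, 1) * x (i, 1)) - e * ev x (L i)"
      by (simp add: ev_lf d_def L_def algebra_simps)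
    then show ?thesis using euler[OF i] Lx[OF i] by simp
  qed
  have lfm: "linear_form i (d i) \<in> multideg Y {i}" if "i < length Y" for i
    by (rule lf_multideg[OF that Y[OF that]])
  have r: "linear_form i (d i) \<in> regular_at z" "L i \<in> regular_at z" "P i \<in> regular_at z" if "i < length Y" for i z
    using lfm[OF that] L[OF that] P[of i] multideg_reg by blast+
  have LN: "prod L ?N \<in> multideg Y ?N" by (rule multideg_prod) (use L in auto)
  have "linear_form i (d i) * P i \<in> multideg Y ?N" if "i < length Y" for i
  proof -
    have "linear_form i (d i) * P i \<in> multideg Y ({i} \<union> (?N - {i}))"
      by (rule multideg_mult[OF lfm[OF that] P]) auto
    moreover have "{i} \<union> (?N - {i}) = ?N" using that by auto
    ultimately show ?thesis by simp
  qed
  moreover have "Poly_Mapping.single 0 e * prod L ?N \<in> multideg Y ?N"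
    using multideg_mult[OF multideg_const LN, of e] by simp
  ultimately have gm: "g \<in> multideg Y ?N"
    unfolding g_def by (intro multideg_add multideg_sum) auto
  have n0: "0 < length Y" using n by linarith
  have Nr: "prod L ?N \<in> regular_at z" for z using LN multideg_reg by blast
  show ?thesis
  proof (intro bexI[of _ g] conjI ballI)
    show "g \<in> twist Y 1 {}" by (rule multideg_twist[OF gm])
    have "ev x (prod L ?N) = 1" using LP[OF n0] r[OF n0] Lx[OF n0] Px by (simp add: ev_mult)
    moreover have "(\<Sum>i\<in>?N. ev x (linear_form i (d i) * P i)) = 0"
      by (rule sum.neutral) (use r dx in \<open>auto simp: ev_mult\<close>)
    ultimately show "ev x g = e" by (simp add: g_def ev_linear(1,4) ev_scale Nr)
    have "ev y (prod L ?N) = 0" using LP[OF n0] r[OF n0] Ly by (simp add: ev_mult)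
    moreover have "(\<Sum>i\<in>?N. ev y (linear_form i (d i) * P i)) = 0"
      by (rule sum.neutral) (use r Py in \<open>auto simp: ev_mult\<close>)
    ultimately show "ev y g = 0" by (simp add: g_def ev_linear(1,4) ev_scale Nr)
    show "der y v g = 0" for v
    proof -
      have "der y v (prod L ?N) = 0" using LP[OF n0] r[OF n0] Ly Py dPy by (simp add: der_mult)
      moreover have "(\<Sum>i\<in>?N. der y v (linear_form i (d i) * P i)) = 0"
        by (rule sum.neutral) (use r Py dPy in \<open>auto simp: der_mult\<close>)
      ultimately show ?thesis by (simp add: g_def der_linear(1,4) der_scale Nr)
    qed
    show "der x v g = c v" if vc: "v \<in> coords Y" for v
    proof -
      obtain a b where v: "v = (a, b)" and a: "a < length Y" and b: "b \<le> 1"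
        using vc Y by (cases v) (auto simp: coords_def)
      have "der x v (prod L ?N) = l a b"
        using LP[OF a] r[OF a] Lx[OF a] Px dPx b by (simp add: v der_mult) (simp add: L_def der_lf)
      moreover have "(\<Sum>i\<in>?N. der x v (linear_form i (d i) * P i)) = (\<Sum>i\<in>?N. if i = a then d a b else 0)"
        using b by (intro sum.cong) (auto simp: v der_mult r dx Px der_lf)
      ultimately show ?thesis using a by (simp add: g_def der_linear(1,4) der_scale Nr d_def v)
    qed
  qed
qed

text \<open>The Euler relation within one factor: \<open>x_w\<close> times the derivative by
  \<open>x_w\<close> multiplies a monomial by its exponent at \<open>w\<close>, and the exponents in
  factor \<open>i\<close> add up to \<open>1\<close>.\<close>

lemma euler_identity:
  assumes f: "f \<in> twist Y 1 W" and i: "i < length Y"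
  shows "(\<Sum>j\<le>Y ! i. x (i, j) * der x (i, j) f) = ev x f"
proof -
  have d: "x w * dmon x w m = of_int (Poly_Mapping.lookup m w) * mon x m" for w m
  proof (cases "Poly_Mapping.lookup m w = 0")
    \<comment> \<open>For a nonzero exponent the identity also holds where \<open>x w = 0\<close>,
      both sides being \<open>0\<close>.\<close>
    case False
    then have "x w powi (Poly_Mapping.lookup m w - 1) * x w = x w powi Poly_Mapping.lookup m w"
      by (intro power_int_minus_mult) simp
    then show ?thesis by (simp add: dmon_def mon_split[of x m w] mult_ac)
  qed (simp add: dmon_def)
  have "(\<Sum>j\<le>Y ! i. x (i, j) * der x (i, j) f) =
      (\<Sum>j\<le>Y ! i. \<Sum>m\<in>Poly_Mapping.keys f. Poly_Mapping.lookup f m * (x (i, j) * dmon x (i, j) m))"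
    unfolding der_def lin_ext_def sum_distrib_left by (simp only: mult_ac)
  also have "\<dots> = (\<Sum>m\<in>Poly_Mapping.keys f. \<Sum>j\<le>Y ! i. Poly_Mapping.lookup f m * (x (i, j) * dmon x (i, j) m))"
    by (rule sum.swap)
  also have "\<dots> = (\<Sum>m\<in>Poly_Mapping.keys f. Poly_Mapping.lookup f m * mon x m)"
  proof (rule sum.cong[OF refl])
    fix m assume "m \<in> Poly_Mapping.keys f"
    then have m: "m \<in> tmon Y 1 W" using f by (auto simp: twist_iff)
    have "(\<Sum>j\<le>Y ! i. Poly_Mapping.lookup f m * (x (i, j) * dmon x (i, j) m)) =
        Poly_Mapping.lookup f m * (of_int (\<Sum>j\<le>Y ! i. Poly_Mapping.lookup m (i, j)) * mon x m)"
      by (simp add: d sum_distrib_left sum_distrib_right)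
    then show "(\<Sum>j\<le>Y ! i. Poly_Mapping.lookup f m * (x (i, j) * dmon x (i, j) m)) =
        Poly_Mapping.lookup f m * mon x m"
      by (simp only: tmonD(3)[OF m i] of_int_1 mult_1_left)
  qed
  finally show ?thesis by (simp add: ev_def lin_ext_def)
qed

text \<open>The jet at \<open>x\<close> of a merely local section satisfies the Euler relations,
  hence is the jet of a global form with zero jet at \<open>y\<close>.\<close>

lemma section_with_jet:
  fixes f :: "'a::field laurent"
  assumes Y: "\<And>i. i < length Y \<Longrightarrow> Y ! i = 1" and n: "length Y \<ge> 3"
    and indep: "\<And>i. i < length Y \<Longrightarrow> x (i, 0) * y (i, 1) - x (i, 1) * y (i, 0) \<noteq> 0"
    and f: "f \<in> twist Y 1 W"
  shows "\<exists>g\<in>twist Y 1 {}. ev x g = ev x f \<and> (\<forall>v\<in>coords Y. der x v g = der x v f) \<and>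
    ev y g = 0 \<and> (\<forall>v\<in>coords Y. der y v g = 0)"
proof -
  have eu: "der x (i, 0) f * x (i, 0) + der x (i, 1) f * x (i, 1) = ev x f" if i: "i < length Y" for i
    using euler_identity[OF f i, of x] Y[OF i] by (simp add: mult.commute)
  show ?thesis by (rule separating_section[where c = "\<lambda>v. der x v f", OF Y n indep eu])
qed

text \<open>A cocycle bounds a 0-cochain \<open>\<sigma>\<close> of the full line bundle.
  Subtracting a global form with the jets of \<open>\<sigma>\<close> at both points moves
  \<open>\<sigma>\<close> into the double-point sheaf and leaves its coboundary unchanged.\<close>

lemma delta_two_points:
  fixes p q :: "'a::field mpoint"
  assumes Y: "\<And>i. i < length Y \<Longrightarrow> Y ! i = 1" and n: "length Y \<ge> 3"
    and p: "p \<in> mpoints Y" and q: "q \<in> mpoints Y" and pq: "\<And>i. i < length Y \<Longrightarrow> p ! i \<noteq> q ! i"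
  shows "\<not> delta Y {p, q} > 0"
proof
  let ?F = "double_sheaf Y {p, q}"
  assume "delta Y {p, q} > 0"
  then have "quotient_dim (cocycles (charts Y) ?F (Suc 0)) (coboundaries (charts Y) ?F (Suc 0)) > 0"
    by (simp add: delta_def cohomology_dim_def del: coboundaries.simps)
  from quotient_dim_pos_ex[OF this] obtain s where
    s: "s \<in> cocycles (charts Y) ?F (Suc 0)" and nb: "s \<notin> coboundaries (charts Y) ?F (Suc 0)" by blast
  note sF = cocycles_1D(1)[OF s]
  obtain \<sigma> where \<sigma>: "\<And>a. a \<in> charts Y \<Longrightarrow> \<sigma> a \<in> twist Y 1 {a}"
    and s\<sigma>: "\<And>a b. a \<in> charts Y \<Longrightarrow> b \<in> charts Y \<Longrightarrow> s [a, b] = \<sigma> b - \<sigma> a"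
  proof (rule cech_H1_twist_1)
    show "s [a, b] \<in> twist Y 1 {a, b}" if "a \<in> charts Y" "b \<in> charts Y" for a b
      by (rule double_sheaf_twist[OF sF[OF that]])
    show "s [a, b] = s [a, c] + s [c, b]" if "a \<in> charts Y" "b \<in> charts Y" "c \<in> charts Y" for a b c
      by (rule cocycles_1D(2)[OF s that])
  qed blast
  obtain xs ys where xs: "list_all2 (\<in>) xs p" and ys: "list_all2 (\<in>) ys q"
    using rep_exists[OF p] rep_exists[OF q] by blast
  obtain Jp Jq where Jp: "Jp \<in> charts Y" "lies_in Y p {Jp}" and Jq: "Jq \<in> charts Y" "lies_in Y q {Jq}"
    using point_in_chart[OF p] point_in_chart[OF q] by blast
  have ixy: "coord_at xs (i, 0) * coord_at ys (i, 1) - coord_at xs (i, 1) * coord_at ys (i, 0) \<noteq> 0" if "i < length Y" for i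
    by (rule P1_points_indep[OF p xs q ys that Y[OF that] pq[OF that]])
  have iyx: "coord_at ys (i, 0) * coord_at xs (i, 1) - coord_at ys (i, 1) * coord_at xs (i, 0) \<noteq> 0" if "i < length Y" for i
    using ixy[OF that] by (simp add: mult.commute)
  obtain g where g: "g \<in> twist Y 1 {}" "ev (coord_at xs) g = ev (coord_at xs) (\<sigma> Jp)"
    "\<forall>v\<in>coords Y. der (coord_at xs) v g = der (coord_at xs) v (\<sigma> Jp)"
    "ev (coord_at ys) g = 0" "\<forall>v\<in>coords Y. der (coord_at ys) v g = 0"
    by (atomize_elim, rule section_with_jet[where x = "coord_at xs" and y = "coord_at ys", OF Y n ixy \<sigma>[OF Jp(1)], unfolded Bex_def])
  obtain h where h: "h \<in> twist Y 1 {}" "ev (coord_at ys) h = ev (coord_at ys) (\<sigma> Jq)"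
    "\<forall>v\<in>coords Y. der (coord_at ys) v h = der (coord_at ys) v (\<sigma> Jq)"
    "ev (coord_at xs) h = 0" "\<forall>v\<in>coords Y. der (coord_at xs) v h = 0"
    by (atomize_elim, rule section_with_jet[where x = "coord_at ys" and y = "coord_at xs", OF Y n iyx \<sigma>[OF Jq(1)], unfolded Bex_def])
  \<comment> \<open>On overlaps containing \<open>z\<close> the difference of two values of
    \<open>\<sigma>\<close> is a section of the double-point sheaf, so the jet of
    \<open>\<sigma>\<close> at \<open>z\<close> does not depend on the chart.\<close>
  have jet: "ev (coord_at zs) (\<sigma> J) = ev (coord_at zs) (\<sigma> J') \<and> der (coord_at zs) v (\<sigma> J) = der (coord_at zs) v (\<sigma> J')"
    if z: "z \<in> {p, q}" "list_all2 (\<in>) zs z" and J: "J \<in> charts Y" "lies_in Y z {J}"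
      and J': "J' \<in> charts Y" "lies_in Y z {J'}" for z zs J J' v
  proof -
    have "z \<in> mpoints Y" using z p q by auto
    moreover have "lies_in Y z {J', J}" using J(2) J'(2) by (simp add: lies_in_def)
    ultimately show ?thesis
      using double_sheaf_jet[OF _ z(2) _ z(1) sF[OF J'(1) J(1)], of v] s\<sigma>[OF J'(1) J(1)]
      by (simp add: ev_linear(2) der_linear(2))
  qed
  have "s \<in> coboundaries (charts Y) ?F (Suc 0)"
  proof (rule coboundaryI[OF s])
    fix J assume J: "J \<in> charts Y"
    \<comment> \<open>\<open>g\<close> matches the jet at \<open>p\<close> and has zero jet at
      \<open>q\<close>; for \<open>h\<close> the roles are exchanged.\<close>
    show "\<sigma> J - (g + h) \<in> ?F {J}"
    proof (rule double_sheaf_if_jets_0[OF _ J])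
      show "{p, q} \<subseteq> mpoints Y" using p q by simp
      have "twist Y 1 {} \<subseteq> (twist Y 1 {J} :: 'a laurent set)" by (rule twist_mono) simp
      then show "\<sigma> J - (g + h) \<in> twist Y 1 {J}"
        using g(1) h(1) by (intro twist_diff \<sigma> J twist_add) auto
      fix z assume z: "z \<in> {p, q}" and lz: "lies_in Y z {J}"
      show "\<exists>zs. list_all2 (\<in>) zs z \<and> ev (coord_at zs) (\<sigma> J - (g + h)) = 0 \<and>
          (\<forall>v\<in>coords Y. der (coord_at zs) v (\<sigma> J - (g + h)) = 0)"
      proof (cases "z = p")
        case True
        then show ?thesis
          using jet[OF z _ J lz Jp(1), of xs] xs Jp(2) g h
          by (intro exI[of _ xs]) (simp add: ev_linear(1,2) der_linear(1,2))
      next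
        case False
        then have "z = q" using z by simp
        then show ?thesis
          using jet[OF z _ J lz Jq(1), of ys] ys Jq(2) g h
          by (intro exI[of _ ys]) (simp add: ev_linear(1,2) der_linear(1,2))
      qed
    qed
  next
    fix a b assume "a \<in> charts Y" "b \<in> charts Y"
    from s\<sigma>[OF this] show "s [a, b] = (\<sigma> b - (g + h)) - (\<sigma> a - (g + h))" by simp
  qed
  with nb show False by simp
qed

lemma T_two_points_empty:
  assumes Y: "multiprojective Y" and n: "sum_list Y \<ge> 3"
  shows "T Y 2 = ({} :: 'a::field mpoint set set)"
proof (rule ccontr)
  assume "T Y 2 \<noteq> ({} :: 'a mpoint set set)"
  then obtain S :: "'a mpoint set" where S: "S \<subseteq> mpoints Y" "card S = 2" "delta Y S > 0" "minimal_for Y S"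
    unfolding T_def T1_def subsets_of_card_def by blast
  then obtain p q where pq: "S = {p, q}" by (auto simp: card_2_iff)
  have i: "Y ! i = 1 \<and> p ! i \<noteq> q ! i" if i: "i < length Y" for i
  proof (rule two_points_span)
    show "Y ! i > 0" using Y i by (simp add: multiprojective_def)
    show "p ! i \<in> proj_space (Y ! i)" "q ! i \<in> proj_space (Y ! i)"
      using S(1) pq i by (auto simp: mpoints_def)
    show "proj_span (Y ! i) {p ! i, q ! i} = proj_space (Y ! i)"
      using S(4) pq i by (simp add: minimal_for_def)
  qed
  then have "sum_list Y = (\<Sum>i<length Y. 1)"
    unfolding sum_list_sum_nth by (intro sum.cong) auto
  then have "length Y \<ge> 3" using n by simp
  then have "\<not> delta Y {p, q} > 0"
    by (intro delta_two_points) (use i S(1) pq in auto)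
  with S(3) pq show False by simp
qed

section \<open>Existence for at least three points\<close>

lemma mon_multi: "mon x (multi Y \<phi>) = (\<Prod>i<length Y. x (i, \<phi> i))"
proof -
  have "Poly_Mapping.keys (multi Y \<phi>) = (\<lambda>i. (i, \<phi> i)) ` {..<length Y}"
    unfolding keys_multi by auto
  then show ?thesis
    unfolding mon_def by (simp add: prod.reindex inj_on_def lookup_multi)
qed

lemma proj_span_P1:
  fixes A :: "'a::field ppoint set"
  assumes A: "A \<subseteq> proj_space 1" and u: "u \<in> \<Union>A" and v: "v \<in> \<Union>A"
    and indep: "u $ 0 * v $ 1 - u $ 1 * v $ 0 \<noteq> 0"
  shows "proj_span 1 A = proj_space 1"
proof -
  interpret vec_space "TYPE('a)" "Suc 1" .
  have W: "\<Union>A \<subseteq> carrier_vec (Suc 1)"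
  proof
    fix w assume "w \<in> \<Union>A"
    then obtain P where "P \<in> proj_space 1" "w \<in> P" using A by blast
    then show "w \<in> carrier_vec (Suc 1)" unfolding proj_space_def by auto
  qed
  have uv: "u \<in> carrier_vec (Suc 1)" "v \<in> carrier_vec (Suc 1)" using W u v by blast+
  have all: "w \<in> span (\<Union>A)" if w: "w \<in> carrier_vec (Suc 1)" for w :: "'a vec"
  proof -
    define D where "D = u $ 0 * v $ 1 - u $ 1 * v $ 0"
    \<comment> \<open>Cramer's rule for writing \<open>w\<close> as a combination of
      \<open>u\<close> and \<open>v\<close>.\<close>
    define a b where "a = (w $ 0 * v $ 1 - w $ 1 * v $ 0) / D" and "b = (u $ 0 * w $ 1 - u $ 1 * w $ 0) / D"
    have D: "D \<noteq> 0" using indep by (simp add: D_def)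
    have "a * u $ 0 + b * v $ 0 = (w $ 0 * D) / D" "a * u $ 1 + b * v $ 1 = (w $ 1 * D) / D"
      unfolding a_def b_def times_divide_eq_left add_divide_distrib[symmetric]
      by (simp_all add: D_def algebra_simps)
    then have ab: "a * u $ 0 + b * v $ 0 = w $ 0" "a * u $ 1 + b * v $ 1 = w $ 1" using D by simp_all
    have "w = a \<cdot>\<^sub>v u + b \<cdot>\<^sub>v v"
    proof (rule eq_vecI)
      fix j assume "j < dim_vec (a \<cdot>\<^sub>v u + b \<cdot>\<^sub>v v)"
      then have "j = 0 \<or> j = 1" using uv by auto
      then show "w $ j = (a \<cdot>\<^sub>v u + b \<cdot>\<^sub>v v) $ j" using uv ab by auto
    qed (use uv w in auto)
    moreover have "a \<cdot>\<^sub>v u \<in> span (\<Union>A)" by (rule smult_in_span[OF W span_mem[OF W u]])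
    moreover have "b \<cdot>\<^sub>v v \<in> span (\<Union>A)" by (rule smult_in_span[OF W span_mem[OF W v]])
    ultimately show ?thesis using span_add1[OF W] by metis
  qed
  show ?thesis unfolding proj_span_def
  proof (intro Set.set_eqI iffI CollectI conjI)
    fix P :: "'a ppoint" assume P: "P \<in> proj_space 1"
    then have "P \<subseteq> carrier_vec (Suc 1)" unfolding proj_space_def by auto
    with all show "P \<subseteq> span (\<Union>A)" by (intro subsetI) (rule all, erule subsetD)
  qed (erule CollectE, erule conjunct1)
qed

section \<open>Points of \<open>(P^1)^n\<close> given by coordinate functions\<close>

definition coord_vecs :: "nat \<Rightarrow> (nat \<times> nat \<Rightarrow> 'a) \<Rightarrow> 'a vec list" where
  "coord_vecs n x = map (\<lambda>i. vec 2 (\<lambda>j. x (i, j))) [0..<n]"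

definition point_of :: "nat \<Rightarrow> (nat \<times> nat \<Rightarrow> 'a::field) \<Rightarrow> 'a mpoint" where
  "point_of n x = map (\<lambda>v. {c \<cdot>\<^sub>v v | c. c \<noteq> 0}) (coord_vecs n x)"

abbreviation valid_coords :: "nat \<Rightarrow> (nat \<times> nat \<Rightarrow> 'a::field) \<Rightarrow> bool" where
  "valid_coords n x \<equiv> \<forall>i<n. x (i, 0) \<noteq> 0 \<or> x (i, 1) \<noteq> 0"

lemma coord_vecs_nth: "i < n \<Longrightarrow> j \<le> 1 \<Longrightarrow> coord_at (coord_vecs n x) (i, j) = x (i, j)"
  by (simp add: coord_vecs_def)

lemma point_of_rep: "list_all2 (\<in>) (coord_vecs n x) (point_of n x)"
proof (rule list_all2_all_nthI)
  fix i assume i: "i < length (coord_vecs n x)"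
  have "1 \<cdot>\<^sub>v (coord_vecs n x ! i) \<in> {c \<cdot>\<^sub>v (coord_vecs n x ! i) | c. c \<noteq> 0}"
    by (intro CollectI exI[of _ 1] conjI refl zero_neq_one[symmetric])
  then show "coord_vecs n x ! i \<in> point_of n x ! i" using i by (simp add: point_of_def)
qed (simp add: point_of_def)

lemma point_of_mpoints:
  assumes x: "valid_coords n x"
  shows "point_of n x \<in> mpoints (replicate n 1)"
proof -
  have "point_of n x ! i \<in> proj_space 1" if i: "i < n" for i
  proof -
    let ?v = "vec 2 (\<lambda>j. x (i, j))"
    have "?v \<noteq> 0\<^sub>v 2"
    proof
      assume "?v = 0\<^sub>v 2"
      then have "?v $ 0 = 0" "?v $ 1 = 0" by simp_all
      with x i show False by simp
    qed
    then have "{c \<cdot>\<^sub>v ?v | c. c \<noteq> 0} \<in> proj_space 1"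
      unfolding proj_space_def by (intro CollectI exI[of _ ?v] conjI refl) (simp_all add: numeral_2_eq_2)
    then show ?thesis using i by (simp add: point_of_def coord_vecs_def)
  qed
  then show ?thesis by (simp add: mpoints_def point_of_def coord_vecs_def)
qed

lemma point_of_eqD:
  assumes eq: "point_of n x = point_of n y" and i: "i < n"
  shows "x (i, 0) * y (i, 1) = x (i, 1) * y (i, 0)"
proof -
  have "coord_vecs n x ! i \<in> point_of n y ! i"
    using point_of_rep[of n x] i unfolding eq by (simp add: list_all2_conv_all_nth coord_vecs_def)
  then obtain c where c: "coord_vecs n x ! i = c \<cdot>\<^sub>v (coord_vecs n y ! i)"
    using i by (auto simp: point_of_def coord_vecs_def)
  have "x (i, j) = c * y (i, j)" if "j < 2" for j
    using arg_cong[OF c, of "\<lambda>v. v $ j"] i that by (simp add: coord_vecs_def)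
  from this[of 0] this[of 1] show ?thesis by simp
qed

lemma lies_in_point_of:
  assumes x: "valid_coords n x" and W: "W \<subseteq> charts (replicate n 1)"
  shows "lies_in (replicate n 1) (point_of n x) W \<longleftrightarrow> (\<forall>J\<in>W. \<forall>i<n. x (i, J ! i) \<noteq> 0)"
proof -
  have "coord_vecs n x ! i $ (J ! i) = x (i, J ! i)" if "J \<in> W" "i < n" for i J
    using that W coord_vecs_nth[of i n "J ! i" x] by (auto simp: charts_def)
  then show ?thesis
    using lies_in_rep[OF point_of_mpoints[OF x] point_of_rep W] by auto
qed

text \<open>When no point of \<open>S\<close> lies in \<open>U_W\<close>, all ideals involved
  contain \<open>1\<close>, and the double points impose no condition there.\<close>

lemma twist_subset_double_sheaf:
  assumes "\<And>p. p \<in> S \<Longrightarrow> \<not> lies_in Y p W" and f: "f \<in> twist Y 1 W"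
  shows "f \<in> double_sheaf Y S W"
proof -
  have "1 \<in> sq_ideal Y p W" if "p \<in> S" for p :: "'a::field mpoint"
  proof -
    have "point_ideal Y p W = twist Y 0 W" using assms(1)[OF that] by (simp add: point_ideal_def)
    then have "1 * 1 \<in> sq_ideal Y p W" by (intro set_product_mult) simp_all
    then show ?thesis by simp
  qed
  then have "1 \<in> double_ideal Y S W" by (simp add: double_ideal_def)
  from set_product_mult[OF this f] show ?thesis by (simp add: double_sheaf_def)
qed

text \<open>All factors except \<open>a\<close> are at \<open>(0 : 1)\<close>. The derivative by
  \<open>x_{(a, 1)}\<close> kills monomials containing \<open>x_{(a, 0)}\<close>, and the values
  kill those containing another \<open>x_{(i, 0)}\<close>; only the product of all
  \<open>x_{(i, 1)}\<close> survives.\<close>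

lemma der_eq_lookup:
  assumes g: "g \<in> twist (replicate n 1) 1 {}" and a: "a < n"
    and x: "\<And>i. i < n \<Longrightarrow> i \<noteq> a \<Longrightarrow> x (i, 0) = 0 \<and> x (i, 1) = 1"
  shows "der x (a, 1) g = Poly_Mapping.lookup g (multi (replicate n 1) (\<lambda>_. 1))"
proof -
  let ?Y = "replicate n (1::nat)" and ?M = "multi (replicate n 1) (\<lambda>_. 1)"
  have "dmon x (a, 1) k = (if k = ?M then 1 else 0)" if "k \<in> Poly_Mapping.keys g" for k
  proof -
    have "k \<in> tmon ?Y 1 {}" using g that by (auto simp: twist_iff)
    then obtain \<phi> where "\<forall>i<length ?Y. \<phi> i \<le> ?Y ! i" and k: "k = multi ?Y \<phi>"
      using tmon_global_multi by blast
    then have \<phi>: "\<phi> i = 0 \<or> \<phi> i = 1" if "i < n" for i using that by fastforce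
    show ?thesis
    proof (cases "\<forall>i<n. \<phi> i = 1")
      case True
      then have "k = ?M" unfolding k by (intro multi_cong) simp
      moreover have "(\<Prod>i\<in>{..<n} - {a}. x (i, 1)) = 1" by (rule prod.neutral) (use x in auto)
      ultimately show ?thesis using a by (simp add: dmon_multi)
    next
      case False
      then obtain i where i: "i < n" "\<phi> i = 0" using \<phi> by blast
      have "Poly_Mapping.lookup k (i, 0) \<noteq> Poly_Mapping.lookup ?M (i, 0)"
        using i by (simp add: k lookup_multi)
      then have ne: "k \<noteq> ?M" by metis
      have "(\<Prod>i\<in>{..<n} - {a}. x (i, \<phi> i)) = 0" if "\<phi> a = 1"
      proof (rule prod_zero)
        have "i \<noteq> a" using that i by auto
        then show "\<exists>i\<in>{..<n} - {a}. x (i, \<phi> i) = 0" using x[OF i(1)] i by (intro bexI[of _ i]) auto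
      qed simp
      then have "dmon x (a, 1) k = 0" using a by (auto simp: k dmon_multi)
      with ne show ?thesis by simp
    qed
  qed
  then have "der x (a, 1) g = (\<Sum>k\<in>Poly_Mapping.keys g. if k = ?M then Poly_Mapping.lookup g ?M else 0)"
    unfolding der_def lin_ext_def by (intro sum.cong) auto
  also have "\<dots> = Poly_Mapping.lookup g ?M" by (simp add: in_keys_iff)
  finally show ?thesis .
qed

lemma h0_pos:
  fixes X :: "(nat \<times> nat \<Rightarrow> 'a::field) set"
  assumes valid: "\<And>x. x \<in> X \<Longrightarrow> valid_coords n x"
    and X: "\<And>x. x \<in> X \<Longrightarrow> \<exists>a b. a < n \<and> b < n \<and> a \<noteq> b \<and> x (a, 0) = 0 \<and> x (b, 0) = 0"
  shows "cohomology_dim (replicate n 1) (double_sheaf (replicate n 1) (point_of n ` X)) 0 > 0"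
proof -
  let ?Y = "replicate n (1::nat)"
  define f :: "'a laurent" where "f = Poly_Mapping.single (multi ?Y (\<lambda>_. 0)) 1"
  define s where "s js = (if js \<in> tuples (charts ?Y) 0 then f else 0)" for js
  have F: "f \<in> double_sheaf ?Y (point_of n ` X) {J}" if J: "J \<in> charts ?Y" for J
  proof (rule double_sheaf_if_jets_0[OF _ J])
    show "point_of n ` X \<subseteq> mpoints ?Y" by (intro image_subsetI point_of_mpoints valid)
    show "f \<in> twist ?Y 1 {J}" unfolding f_def by (intro twist_single multi_tmon) simp
    fix p assume "p \<in> point_of n ` X"
    then obtain x where x: "x \<in> X" and p: "p = point_of n x" by blast
    obtain a b where ab: "a < n" "b < n" "a \<noteq> b" "x (a, 0) = 0" "x (b, 0) = 0" using X[OF x] by blast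
    let ?x = "coord_at (coord_vecs n x)"
    have z: "?x (a, 0) = 0" "?x (b, 0) = 0"
      using ab coord_vecs_nth[of a n 0 x] coord_vecs_nth[of b n 0 x] by simp_all
    have "(\<Prod>i<n. ?x (i, 0)) = 0"
      by (rule prod_zero) (use ab z in auto)
    then have "ev ?x f = 0" by (simp add: f_def ev_linear mon_multi)
    moreover have "der ?x v f = 0" if "v \<in> coords ?Y" for v
    proof -
      obtain i j where v: "v = (i, j)" "i < n" using \<open>v \<in> coords ?Y\<close> by (auto simp: coords_def)
      \<comment> \<open>Differentiation drops the factor \<open>i\<close>, and at least one of the
        two zero factors \<open>a\<close>, \<open>b\<close> remains.\<close>
      have "\<exists>k\<in>{..<n} - {i}. ?x (k, 0) = 0"
        using ab z by (cases "i = a") auto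
      then have "(\<Prod>k\<in>{..<n} - {i}. ?x (k, 0)) = 0" by (intro prod_zero) auto
      then show ?thesis using v by (simp add: f_def der_linear dmon_multi)
    qed
    ultimately show "\<exists>xs. list_all2 (\<in>) xs p \<and> ev (coord_at xs) f = 0 \<and> (\<forall>v\<in>coords ?Y. der (coord_at xs) v f = 0)"
      unfolding p by (intro exI[of _ "coord_vecs n x"] conjI point_of_rep ballI)
  qed
  have "quotient_dim (cocycles (charts ?Y) (double_sheaf ?Y (point_of n ` X)) 0) {\<lambda>_. 0} > 0"
  proof (rule quotient_dim_posI)
    show "s \<in> cocycles (charts ?Y) (double_sheaf ?Y (point_of n ` X)) 0"
      unfolding s_def by (rule cocycles_0I) (rule F)
    fix c assume "(\<lambda>js. Poly_Mapping.single 0 c * s js) \<in> {\<lambda>_. 0}"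
    then have z: "Poly_Mapping.single 0 c * s js = 0" for js by (auto dest: fun_cong)
    have "replicate n 0 \<in> charts ?Y" by (simp add: charts_def)
    then have "s [replicate n 0] = f" by (simp add: s_def tuples_0)
    with z[of "[replicate n 0]"] have "Poly_Mapping.single (multi ?Y (\<lambda>_. 0)) c = 0"
      by (simp add: f_def mult_single)
    then have "Poly_Mapping.lookup (Poly_Mapping.single (multi ?Y (\<lambda>_. 0)) c) (multi ?Y (\<lambda>_. 0)) = 0"
      by simp
    then show "c = 0" by simp
  qed
  then show ?thesis by (simp add: cohomology_dim_def)
qed

text \<open>The point with \<open>(1 : 0)\<close> in factor \<open>a\<close> and
  \<open>(0 : 1)\<close> in all others, written with coordinates \<open>0\<close> and
  \<open>1\<close>.\<close>

definition coord_pt :: "nat \<Rightarrow> nat \<times> nat \<Rightarrow> 'a::field" where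
  "coord_pt a v = (if (fst v = a) = (snd v = 0) then 1 else 0)"

lemma coord_pt_simps [simp]:
  "coord_pt a (a, 0) = 1" "coord_pt a (a, 1) = 0" "coord_pt a (a, Suc 0) = 0"
  "i \<noteq> a \<Longrightarrow> coord_pt a (i, 0) = 0" "i \<noteq> a \<Longrightarrow> coord_pt a (i, 1) = 1"
  "i \<noteq> a \<Longrightarrow> coord_pt a (i, Suc 0) = 1"
  by (simp_all add: coord_pt_def)

lemma coord_pt_valid: "valid_coords n (coord_pt a)"
  by (auto simp: coord_pt_def)

text \<open>The cocycle asks for the jet of the monomial \<open>m\<close> at
  \<open>coord_pt 1\<close> and the zero jet at all other points. No global form has it: the
  coefficient of \<open>m\<close> would be \<open>0\<close> at \<open>coord_pt 0\<close> and nonzero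
  at \<open>coord_pt 1\<close>.\<close>

lemma delta_pos:
  fixes X :: "(nat \<times> nat \<Rightarrow> 'a::field) set"
  assumes n: "n \<ge> 2" and valid: "\<And>x. x \<in> X \<Longrightarrow> valid_coords n x"
    and X: "coord_pt 0 \<in> X" "coord_pt 1 \<in> X"
    and others: "\<And>x. x \<in> X \<Longrightarrow> x \<noteq> coord_pt 1 \<Longrightarrow> x (1, 0) = 0"
  shows "delta (replicate n 1) (point_of n ` X) > 0"
proof -
  let ?Y = "replicate n (1::nat)" and ?S = "point_of n ` X"
  let ?I = "charts ?Y" and ?F = "double_sheaf ?Y ?S"
  define chart :: "nat \<Rightarrow> nat list" where "chart a = map (\<lambda>i. if i = a then 0 else 1) [0..<n]" for a
  define m where "m = multi ?Y (\<lambda>_. 1)"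
  \<comment> \<open>\<open>chart 1\<close> is the only chart containing \<open>coord_pt 1\<close>,
    and it contains no other point of the configuration.\<close>
  define \<sigma> :: "nat list \<Rightarrow> 'a laurent" where "\<sigma> J = (if J = chart 1 then Poly_Mapping.single m 1 else 0)" for J
  define s where "s js = (if js \<in> tuples ?I (Suc 0) then \<sigma> (js ! 1) - \<sigma> (js ! 0) else 0)" for js
  have chart: "chart a \<in> ?I" for a by (auto simp: chart_def charts_def)
  have chart_nth: "chart a ! i = (if i = a then 0 else 1)" if "i < n" for a i
    using that by (simp add: chart_def)
  have ne: "chart 0 \<noteq> chart 1"
    using chart_nth[of 0 0] chart_nth[of 0 1] n by auto
  have lies: "lies_in ?Y (point_of n (coord_pt a :: _ \<Rightarrow> 'a)) {chart a}" for a
  proof -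
    have valid_pt: "valid_coords n (coord_pt a :: _ \<Rightarrow> 'a)" by (rule coord_pt_valid)
    have "coord_pt a (i, chart a ! i) \<noteq> (0::'a)" if "i < n" for i
      unfolding chart_nth[OF that] by (simp add: coord_pt_def)
    then show ?thesis
      using lies_in_point_of[OF valid_pt, of "{chart a}"] chart[of a] by simp
  qed
  have m: "m \<in> tmon ?Y 1 W" for W unfolding m_def by (intro multi_tmon) simp
  have \<sigma>_twist: "\<sigma> J \<in> twist ?Y 1 W" for J W
    unfolding \<sigma>_def by (split if_split) (intro conjI impI twist_single m twist_0)
  \<comment> \<open>\<open>coord_pt 1\<close> fails to lie in \<open>J\<close>, and every other
    point fails to lie in \<open>chart 1\<close> because its coordinate \<open>(1, 0)\<close> is
    zero.\<close>
  have outside: "\<not> lies_in ?Y p {chart 1, J}" if J: "J \<in> ?I" "J \<noteq> chart 1" and p: "p \<in> ?S" for J p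
  proof -
    obtain x where x: "x \<in> X" "p = point_of n x" using p by blast
    have W: "{chart 1, J} \<subseteq> ?I" using J chart by simp
    show ?thesis
    proof (cases "x = coord_pt 1")
      case True
      have "\<exists>i<n. J ! i \<noteq> chart 1 ! i"
        using J chart[of 1] nth_equalityI[of J "chart 1"] by (auto simp: charts_def)
      then obtain i where i: "i < n" "J ! i \<noteq> chart 1 ! i" by blast
      moreover have "J ! i \<le> 1" using J(1) i(1) by (auto simp: charts_def)
      ultimately have "x (i, J ! i) = 0"
        unfolding True chart_nth[OF i(1)] by (auto simp: coord_pt_def split: if_splits)
      then show ?thesis using lies_in_point_of[OF valid[OF x(1)] W] i(1) x(2) by auto
    next
      case False
      have "chart 1 ! 1 = 0" using n by (simp add: chart_nth)
      then have "x (1, chart 1 ! 1) = 0" using others[OF x(1) False] by simp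
      then show ?thesis using lies_in_point_of[OF valid[OF x(1)] W] n x(2) by auto
    qed
  qed
  have sF: "\<sigma> b - \<sigma> a \<in> ?F {a, b}" if ab: "a \<in> ?I" "b \<in> ?I" for a b
  proof (cases "(a = chart 1) = (b = chart 1)")
    case True
    then have "\<sigma> b - \<sigma> a = 0" by (simp add: \<sigma>_def)
    then show ?thesis by (simp add: double_sheaf_def)
  next
    case False
    have "\<not> lies_in ?Y p {a, b}" if "p \<in> ?S" for p
    proof (cases "a = chart 1")
      case True
      then show ?thesis using outside[OF ab(2) _ that] False by simp
    next
      case a: False
      then have "b = chart 1" using False by simp
      then show ?thesis using outside[OF ab(1) a that] by (simp add: insert_commute)
    qed
    then show ?thesis by (intro twist_subset_double_sheaf twist_diff \<sigma>_twist)
  qed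
  have s_cocycle: "s \<in> cocycles ?I ?F (Suc 0)"
  proof -
    have "s \<in> cochains ?I ?F (Suc 0)"
      unfolding cochains_def
    proof (intro CollectI allI)
      fix js
      show "if js \<in> tuples ?I (Suc 0) then s js \<in> ?F (set js) else s js = 0"
      proof (cases "js \<in> tuples ?I (Suc 0)")
        case True
        then obtain a b where ab: "a \<in> ?I" "b \<in> ?I" "js = [a, b]" by (auto simp: tuples_1)
        have "s js = \<sigma> b - \<sigma> a" using True by (simp add: s_def ab(3))
        then show ?thesis using True sF[OF ab(1,2)] by (simp add: ab(3))
      qed (simp add: s_def)
    qed
    moreover have "differential ?I (Suc 0) s js = 0" for js
    proof (cases "js \<in> tuples ?I (Suc (Suc 0))")
      case True
      then obtain a b c where abc: "a \<in> ?I" "b \<in> ?I" "c \<in> ?I" "js = [a, b, c]" by (auto simp: tuples_2)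
      have "s [u, v] = \<sigma> v - \<sigma> u" if "u \<in> ?I" "v \<in> ?I" for u v
        using that by (simp add: s_def tuples_1)
      then show ?thesis using differential_1[OF abc(1-3), of s] abc by simp
    qed (simp add: differential_def)
    ultimately show ?thesis by (simp add: cocycles_def fun_eq_iff)
  qed
  have s_pair: "s [a, b] = \<sigma> b - \<sigma> a" if "a \<in> ?I" "b \<in> ?I" for a b
    using that by (simp add: s_def tuples_1)
  have "quotient_dim (cocycles ?I ?F (Suc 0)) (coboundaries ?I ?F (Suc 0)) > 0"
  proof (rule quotient_dim_posI[OF s_cocycle])
    fix c assume "(\<lambda>js. Poly_Mapping.single 0 c * s js) \<in> coboundaries ?I ?F (Suc 0)"
    then obtain \<tau> where \<tau>: "\<tau> \<in> cochains ?I ?F 0"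
      and d: "(\<lambda>js. Poly_Mapping.single 0 c * s js) = differential ?I 0 \<tau>" by auto
    define C where "C = (Poly_Mapping.single 0 c :: 'a laurent)"
    have \<tau>F: "\<tau> [J] \<in> ?F {J}" if "J \<in> ?I" for J
      using cochainsD(1)[OF \<tau>, of "[J]"] that by (simp add: tuples_0)
    \<comment> \<open>If \<open>c\<close> times the cocycle is the coboundary of
      \<open>\<tau>\<close>, then \<open>\<tau>\<close> and \<open>C * \<sigma>\<close> differ by
      the same element on all charts, which is therefore a global form \<open>g\<close>.\<close>
    have eq: "\<tau> [b] - C * \<sigma> b = \<tau> [a] - C * \<sigma> a" if "a \<in> ?I" "b \<in> ?I" for a b
      using fun_cong[OF d, of "[a, b]"] differential_0[OF that, of \<tau>] s_pair[OF that]
      by (simp add: C_def algebra_simps)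
    define g where "g = \<tau> [chart 0]"
    have g: "g = \<tau> [J] - C * \<sigma> J" if "J \<in> ?I" for J
      using eq[OF that chart[of 0]] ne by (simp add: g_def \<sigma>_def)
    have "multiprojective ?Y" using n by (auto simp: multiprojective_def)
    moreover have "g \<in> twist ?Y 1 {J}" if "J \<in> ?I" for J
      unfolding g[OF that] C_def by (intro twist_diff twist_scale \<sigma>_twist double_sheaf_twist[OF \<tau>F[OF that]])
    ultimately have gt: "g \<in> twist ?Y 1 {}" by (intro twist_global)
    have der: "der (coord_at (coord_vecs n (coord_pt a))) (a, 1) h = Poly_Mapping.lookup h m"
      if "a < n" "h \<in> twist ?Y 1 {}" for a and h :: "'a laurent"
      unfolding m_def
    proof (rule der_eq_lookup[OF that(2,1)])
      fix i assume "i < n" "i \<noteq> a"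
      then show "coord_at (coord_vecs n (coord_pt a)) (i, 0) = (0::'a) \<and> coord_at (coord_vecs n (coord_pt a)) (i, 1) = (1::'a)"
        by (simp add: coord_vecs_def)
    qed
    have jet0: "der (coord_at (coord_vecs n (coord_pt a))) v (\<tau> [chart a]) = 0" if "a = 0 \<or> a = 1" for a v
    proof -
      have "point_of n (coord_pt a) \<in> ?S" using X that by (intro imageI) (elim disjE, simp_all only:)
      from double_sheaf_jet[OF point_of_mpoints[OF coord_pt_valid] point_of_rep lies this \<tau>F[OF chart], of v]
      show ?thesis by (elim conjE)
    qed
    have "Poly_Mapping.lookup g m = 0"
      using der[of 0 g] jet0[of 0 "(0, 1)"] gt n by (simp add: g_def)
    \<comment> \<open>On \<open>chart 1\<close> the coefficient of \<open>m\<close> is shifted by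
      \<open>c\<close>, and the zero jet of \<open>\<tau>\<close> at \<open>coord_pt 1\<close>
      forces the shifted coefficient to vanish as well.\<close>
    moreover have "\<tau> [chart 1] = g + Poly_Mapping.single m c"
      using g[OF chart[of 1]] by (simp add: C_def \<sigma>_def mult_single)
    moreover have "g + Poly_Mapping.single m c \<in> twist ?Y 1 {}"
      by (intro twist_add gt twist_single m)
    ultimately have "Poly_Mapping.lookup (g + Poly_Mapping.single m c) m = 0"
      using der[of 1 "g + Poly_Mapping.single m c"] jet0[of 1 "(1, 1)"] n by simp
    with \<open>Poly_Mapping.lookup g m = 0\<close> show "c = 0" by (simp add: lookup_add)
  qed
  then show ?thesis by (simp add: delta_def cohomology_dim_def del: coboundaries.simps)
qed

text \<open>The point with \<open>(0 : 1)\<close> in factors \<open>0\<close> and \<open>1\<close>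
  and with \<open>(1 : t)\<close> in all remaining factors.\<close>

definition diag_pt :: "'a::field \<Rightarrow> nat \<times> nat \<Rightarrow> 'a" where
  "diag_pt t v = (if fst v < 2 then (if snd v = 0 then 0 else 1) else (if snd v = 0 then 1 else t))"

lemma diag_pt_valid: "valid_coords n (diag_pt t)"
  by (simp add: diag_pt_def)

lemma T_nonempty:
  assumes n: "n \<ge> 3" and r: "r \<ge> 3"
  shows "\<exists>S :: 'a::field_char_0 mpoint set. S \<in> T (replicate n 1) r"
proof -
  let ?Y = "replicate n (1::nat)"
  \<comment> \<open>The parameters \<open>of_nat k\<close> are distinct in characteristic
    \<open>0\<close>. Together with the two coordinate points they give \<open>r\<close>
    points.\<close>
  define D :: "(nat \<times> nat \<Rightarrow> 'a) set" where "D = (\<lambda>k. diag_pt (of_nat k)) ` {..<r - 2}"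
  define X where "X = insert (coord_pt 0) (insert (coord_pt 1) D)"
  define S where "S = point_of n ` X"
  have X_cases: "x = coord_pt 0 \<or> x = coord_pt 1 \<or> (\<exists>t. x = diag_pt t)" if "x \<in> X" for x
    using that by (auto simp: X_def D_def)
  have valid: "valid_coords n x" if "x \<in> X" for x
    using X_cases[OF that] by (elim disjE exE; hypsubst) (rule coord_pt_valid diag_pt_valid)+
  have SY: "S \<subseteq> mpoints ?Y" unfolding S_def by (intro image_subsetI point_of_mpoints valid)
  have pq: "point_of n (coord_pt 0 :: _ \<Rightarrow> 'a) \<noteq> point_of n (coord_pt 1)"
    using point_of_eqD[of n "coord_pt 0 :: _ \<Rightarrow> 'a" "coord_pt 1" 0] n by auto
  \<comment> \<open>In factor \<open>a\<close> the coordinate point is \<open>(1 : 0)\<close>, while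
    every diagonal point is \<open>(0 : 1)\<close> there.\<close>
  have pD: "point_of n (coord_pt a :: _ \<Rightarrow> 'a) \<notin> point_of n ` D" if "a < 2" for a
  proof
    assume "point_of n (coord_pt a :: _ \<Rightarrow> 'a) \<in> point_of n ` D"
    then obtain t where "point_of n (coord_pt a :: _ \<Rightarrow> 'a) = point_of n (diag_pt t)"
      by (auto simp: D_def)
    from point_of_eqD[OF this, of a] show False using n that by (simp add: diag_pt_def)
  qed
  have injD: "inj_on (\<lambda>k. point_of n (diag_pt (of_nat k :: 'a))) {..<r - 2}"
  proof (rule inj_onI)
    fix k l assume "point_of n (diag_pt (of_nat k :: 'a)) = point_of n (diag_pt (of_nat l))"
    \<comment> \<open>Factor \<open>2\<close> exists because \<open>n \<ge> 3\<close>, and there the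
      points are \<open>(1 : t)\<close> with different \<open>t\<close>.\<close>
    from point_of_eqD[OF this, of 2] show "k = l" using n by (simp add: diag_pt_def)
  qed
  have "card (point_of n ` D) = r - 2"
    unfolding D_def image_image using card_image[OF injD] by simp
  moreover have "finite (point_of n ` D)" by (simp add: D_def)
  moreover have "S = insert (point_of n (coord_pt 0)) (insert (point_of n (coord_pt 1)) (point_of n ` D))"
    by (simp add: S_def X_def)
  ultimately have "card S = r" "finite S" using pq pD[of 0] pD[of 1] r by simp_all
  then have Scard: "S \<in> subsets_of_card ?Y r" using SY by (simp add: subsets_of_card_def)
  have h0: "cohomology_dim ?Y (double_sheaf ?Y S) 0 > 0"
    unfolding S_def
  proof (rule h0_pos[OF valid])
    fix x assume "x \<in> X"
    from X_cases[OF this] consider "x = coord_pt 0" | "x = coord_pt 1" | t where "x = diag_pt t"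
      by blast
    then show "\<exists>a b. a < n \<and> b < n \<and> a \<noteq> b \<and> x (a, 0) = 0 \<and> x (b, 0) = 0"
    proof cases
      case 1
      then show ?thesis using n by (intro exI[of _ 1] exI[of _ 2]) simp
    next
      case 2
      then show ?thesis using n by (intro exI[of _ 0] exI[of _ 2]) simp
    next
      case 3
      then show ?thesis using n by (intro exI[of _ 0] exI[of _ 1]) (simp add: diag_pt_def)
    qed
  qed
  have delta: "delta ?Y S > 0"
    unfolding S_def
  proof (rule delta_pos[OF _ valid])
    show "x (1, 0) = 0" if "x \<in> X" "x \<noteq> coord_pt 1" for x
      using that by (auto simp: X_def D_def diag_pt_def)
  qed (use n in \<open>auto simp: X_def\<close>)
  have "minimal_for ?Y S"
    unfolding minimal_for_def
  proof (intro allI impI)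
    fix i assume "i < length ?Y"
    then have i: "i < n" by simp
    \<comment> \<open>In factors \<open>0\<close> and \<open>1\<close> the two coordinate points
      span. In the others \<open>coord_pt 0\<close> gives \<open>(0 : 1)\<close> and the diagonal
      point with \<open>t = 0\<close> gives \<open>(1 : 0)\<close>; that point is present because
      \<open>r \<ge> 3\<close>.\<close>
    obtain x y where xy: "x \<in> X" "y \<in> X" and det: "x (i, 0) * y (i, 1) - x (i, 1) * y (i, 0) \<noteq> 0"
    proof (cases "i < 2")
      case True
      then have b: "1 - i < 2" "1 - i \<noteq> i" by arith+
      have mem: "coord_pt a \<in> X" if "a < 2" for a
      proof -
        have "a = 0 \<or> a = 1" using that by arith
        then show ?thesis unfolding X_def by blast
      qed
      show ?thesis
      proof (rule that[OF mem[OF True] mem[OF b(1)]])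
        show "coord_pt i (i, 0) * coord_pt (1 - i) (i, 1) - coord_pt i (i, 1) * coord_pt (1 - i) (i, 0) \<noteq> (0::'a)"
          using b(2) unfolding coord_pt_simps(1,2) coord_pt_simps(4,5)[OF b(2)[symmetric]] by simp
      qed
    next
      case False
      have d: "diag_pt (of_nat 0) \<in> X" unfolding X_def D_def using r by (intro insertI2 imageI) simp
      have c: "coord_pt 0 \<in> X" by (simp add: X_def)
      show ?thesis by (rule that[OF d c]) (use False in \<open>simp add: diag_pt_def\<close>)
    qed
    let ?u = "coord_vecs n x ! i" and ?v = "coord_vecs n y ! i"
    have rep: "coord_vecs n z ! i \<in> point_of n z ! i" for z :: "nat \<times> nat \<Rightarrow> 'a"
      using point_of_rep[of n z] i by (simp add: list_all2_conv_all_nth coord_vecs_def)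
    have rep': "coord_vecs n z ! i \<in> \<Union>((\<lambda>p. p ! i) ` S)" if "z \<in> X" for z
    proof -
      have "point_of n z \<in> S" unfolding S_def by (rule imageI[OF that])
      then show ?thesis using rep by (rule UN_I)
    qed
    have "proj_span 1 ((\<lambda>p. p ! i) ` S) = proj_space 1"
    proof (rule proj_span_P1)
      show "(\<lambda>p. p ! i) ` S \<subseteq> proj_space 1" using SY i by (auto simp: mpoints_def)
      show "?u \<in> \<Union>((\<lambda>p. p ! i) ` S)" "?v \<in> \<Union>((\<lambda>p. p ! i) ` S)"
        by (rule rep'[OF xy(1)]) (rule rep'[OF xy(2)])
      show "?u $ 0 * ?v $ 1 - ?u $ 1 * ?v $ 0 \<noteq> 0"
        using det i by (simp add: coord_vecs_def)
    qed
    then show "proj_span (?Y ! i) ((\<lambda>p. p ! i) ` S) = proj_space (?Y ! i)" using i by simp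
  qed
  with Scard h0 delta have "S \<in> T ?Y r" unfolding T_def T1_def by (intro CollectI conjI)
  then show ?thesis by blast
qed

theorem proposition5p11:
  fixes n r :: nat
  assumes "n \<ge> 2" and "r \<ge> 2"
  shows "(E n r :: (mspace \<times> 'a::{alg_closed_field, field_char_0} mpoint set) set) \<noteq> {}
           \<longleftrightarrow> n \<ge> 3 \<and> r \<ge> 3"
proof
  assume "(E n r :: (mspace \<times> 'a mpoint set) set) \<noteq> {}"
  then obtain Y and S :: "'a mpoint set" where
    Y: "multiprojective Y" "sum_list Y = n" and S: "S \<in> T Y r"
    unfolding E_def by blast
  then have SY: "S \<subseteq> mpoints Y" "card S = r" and h0: "cohomology_dim Y (double_sheaf Y S) 0 > 0"
    unfolding T_def T1_def subsets_of_card_def by blast+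
  have "\<not> card S \<le> Suc 0" using SY(2) assms(2) by simp
  then obtain p q where pq: "p \<in> S" "q \<in> S" "p \<noteq> q"
    using card_le_Suc0_iff_eq[of S] SY(2) assms(2) by (metis card.infinite le0)
  have "n \<noteq> 2" using h0_dim_2[OF Y(1) _ SY(1) pq] Y(2) h0 by blast
  moreover have "r \<noteq> 2" if "n \<ge> 3" using T_two_points_empty[OF Y(1)] Y(2) that S by blast
  ultimately show "n \<ge> 3 \<and> r \<ge> 3" using assms by linarith
next
  assume nr: "n \<ge> 3 \<and> r \<ge> 3"
  then obtain S :: "'a mpoint set" where "S \<in> T (replicate n 1) r"
    using T_nonempty by blast
  then have "(replicate n 1, S) \<in> E n r"
    using nr by (simp add: E_def multiprojective_def sum_list_replicate)
  then show "(E n r :: (mspace \<times> 'a mpoint set) set) \<noteq> {}" by blast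
qed

end
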